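(* Assume that the feature dimension is larger than the number of classes, $d>K$, and that the number of training samples in each class is balanced (equal to $n$ for each of the $K$ classes). Then the function $f(\boldsymbol W,\boldsymbol H,\boldsymbol b)$ on $\mathbb R^{K\times d}\times\mathbb R^{d\times N}\times\mathbb R^K$ is a strict saddle function with no spurious local minimum, in the following sense. (1) Any local minimizer $(\boldsymbol W^\star,\boldsymbol H^\star,\boldsymbol b^\star)$ of $f$ is a global minimizer of $f$ of the following form: $$w^\star:=\|\boldsymbol w^{\star 1}\|_2=\|\boldsymbol w^{\star 2}\|_2=\cdots=\|\boldsymbol w^{\star K}\|_2,\qquad \boldsymbol b^\star=b^\star\boldsymbol 1\ \text{ (with } b^\star\in\mathbb R),$$ $$\boldsymbol h^\star_{k,i}=\sqrt{\frac{\lambda_{\boldsymbol W}}{\lambda_{\boldsymbol H}\,n}}\;\boldsymbol w^{\star k}\quad\forall k\in[K],\ i\in[n],\qquad \overline{\boldsymbol h}^\star_i:=\frac1K\sum_{j=1}^K\boldsymbol h^\star_{j,i}=\boldsymbol 0\quad\forall i\in[n],$$ where either $b^\star=0$ or $\lambda_{\boldsymbol b}=0$, and the matrix $\boldsymbol W^{\star\top}\in\mathbb R^{d\times K}$ forms a $K$-Simplex ETF up to some scaling and rotation, in the sense that for any $\boldsymbol U\in\mathbb R^{d\times d}$ with $\boldsymbol U^\top\boldsymbol U=\boldsymbol I_d$, the normalized matrix $\boldsymbol M:=\frac1{w^\star}\boldsymbol U\boldsymbol W^{\star\top}$ satisfies $\boldsymbol M^\top\boldsymbol M=\frac{K}{K-1}\big(\boldsymbol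 I_K-\frac1K\boldsymbol 1_K\boldsymbol 1_K^\top\big)$. (2) Any critical point $(\boldsymbol W,\boldsymbol H,\boldsymbol b)$ of $f$ that is not a local minimizer is a strict saddle with negative curvature, i.e. the Hessian $\nabla^2 f(\boldsymbol W,\boldsymbol H,\boldsymbol b)$ at this critical point is non-degenerate and has at least one negative eigenvalue, i.e. there exists $i$ with $\lambda_i\big(\nabla^2 f(\boldsymbol W,\boldsymbol H,\boldsymbol b)\big)<0$.
   Context: Let $K\ge 2$ (number of classes), $n\ge1$ (samples per class), $d\ge 1$ (feature dimension) be integers, $N=nK$, and let $\lambda_{\boldsymbol W},\lambda_{\boldsymbol H}>0$, $\lambda_{\boldsymbol b}\ge 0$. Write $[m]=\{1,\dots,m\}$, $\boldsymbol I_m$ for the $m\times m$ identity matrix, and $\boldsymbol 1$ (or $\boldsymbol 1_K$) for the all-ones vector in $\mathbb R^K$. For $k\in[K]$ let $\boldsymbol y_k\in\mathbb R^K$ be the one-hot vector with $k$-th entry $1$. The cross-entropy loss of $\boldsymbol z\in\mathbb R^K$ with label $\boldsymbol y_k$ is $$\mathcal L_{\mathrm{CE}}(\boldsymbol z,\boldsymbol y_k)=-\log\left(\frac{\exp(z_k)}{\sum_{i=1}^K\exp(z_i)}\right).$$ For $\boldsymbol W\in\mathbb R^{K\times d}$ with rows $(\boldsymbol w^1)^\top,\dots,(\boldsymbol w^K)^\top$, $\boldsymbol H=[\boldsymbol h_{1,1}\ \cdots\ \boldsymbol h_{K,n}]\in\mathbb R^{d\times N}$ with columns $\boldsymbol h_{k,i}\in\mathbb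 R^d$ ($k\in[K]$, $i\in[n]$), and $\boldsymbol b\in\mathbb R^K$, define $$f(\boldsymbol W,\boldsymbol H,\boldsymbol b)=\frac1{Kn}\sum_{k=1}^K\sum_{i=1}^n\mathcal L_{\mathrm{CE}}(\boldsymbol W\boldsymbol h_{k,i}+\boldsymbol b,\boldsymbol y_k)+\frac{\lambda_{\boldsymbol W}}2\|\boldsymbol W\|_F^2+\frac{\lambda_{\boldsymbol H}}2\|\boldsymbol H\|_F^2+\frac{\lambda_{\boldsymbol b}}2\|\boldsymbol b\|_2^2 .$$ A superscript $\star$ on $\boldsymbol w^{k}$, $\boldsymbol h_{k,i}$ refers to the rows of $\boldsymbol W^\star$ and the columns of $\boldsymbol H^\star$. A (general) $K$-Simplex ETF is the collection of points in $\mathbb R^d$ given by the columns of $\sqrt{\frac{K}{K-1}}\,\boldsymbol P(\boldsymbol I_K-\frac1K\boldsymbol 1_K\boldsymbol 1_K^\top)$ with $\boldsymbol P\in\mathbb R^{d\times K}$, $\boldsymbol P^\top\boldsymbol P=\boldsymbol I_K$. A critical point is a point where $\nabla f=\boldsymbol 0$; $\lambda_i(\cdot)$ denotes the eigenvalues of the (symmetric) Hessian of $f$ with respect to all variables $(\boldsymbol W,\boldsymbol H,\boldsymbol b)$.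
   Formalization: The identity for M is claimed only if w* is nonzero (for K²nλ_Wλ_H ≥ 1 the minimizer has W* = 0 and M is undefined); "non-degenerate" is read only as having a negative eigenvalue, since nonsingularity fails, e.g. at the origin if λ_b = 0 and K²nλ_Wλ_H < 1. *)

theory Defs
  imports "HOL-Analysis.Analysis"
begin

text \<open>
  The classes, the samples per class and the feature coordinates are indexed by finite
  types \<open>'k\<close>, \<open>'n\<close>, \<open>'d\<close>, so that the integers \<open>K\<close>, \<open>n\<close>, \<open>d\<close> are
  \<open>CARD('k)\<close>, \<open>CARD('n)\<close>, \<open>CARD('d)\<close>, and \<open>N = n K\<close> is \<open>CARD('k \<times> 'n)\<close>.
  The norms of the types \<open>real^'d^'k\<close> and \<open>real^('k \<times> 'n)^'d\<close> are the Frobenius norms,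
  and the product type of the triples \<open>(W, H, b)\<close> carries the Euclidean inner product of
  all their entries.
\<close>

definition ce_loss :: "real^'k \<Rightarrow> 'k \<Rightarrow> real" where
  "ce_loss z k = - ln (exp (z $ k) / (\<Sum>i\<in>UNIV. exp (z $ i)))"

definition ufm_obj ::
  "real \<Rightarrow> real \<Rightarrow> real \<Rightarrow> (real^'d^'k) \<times> (real^('k \<times> 'n::finite)^'d) \<times> (real^'k) \<Rightarrow> real" where
  "ufm_obj lW lH lb = (\<lambda>(W, H, b).
     1 / (real CARD('k) * real CARD('n)) *
       (\<Sum>k\<in>UNIV. \<Sum>i\<in>UNIV. ce_loss (W *v column (k, i) H + b) k)
     + lW / 2 * (norm W)\<^sup>2 + lH / 2 * (norm H)\<^sup>2 + lb / 2 * (norm b)\<^sup>2)"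

definition local_minimizer :: "('a::topological_space \<Rightarrow> real) \<Rightarrow> 'a \<Rightarrow> bool" where
  "local_minimizer f x \<longleftrightarrow> (\<forall>\<^sub>F y in nhds x. f x \<le> f y)"

definition global_minimizer :: "('a \<Rightarrow> real) \<Rightarrow> 'a \<Rightarrow> bool" where
  "global_minimizer f x \<longleftrightarrow> (\<forall>y. f x \<le> f y)"

definition critical_point :: "('a::real_inner \<Rightarrow> real) \<Rightarrow> 'a \<Rightarrow> bool" where
  "critical_point f x \<longleftrightarrow> (GDERIV f x :> 0)"

text \<open>
  The Hessian is taken as a linear operator, the derivative of the gradient field; on a
  Euclidean space it is the operator whose matrix in the standard basis consists of the
  second partial derivatives.
\<close>

definition has_hessian :: "('a::real_inner \<Rightarrow> real) \<Rightarrow> ('a \<Rightarrow> 'a) \<Rightarrow> 'a \<Rightarrow> bool" where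
  "has_hessian f A x \<longleftrightarrow>
     (\<exists>g. (\<forall>\<^sub>F y in nhds x. GDERIV f y :> g y) \<and> (g has_derivative A) (at x))"

definition eigenvalue_of :: "('a::real_vector \<Rightarrow> 'a) \<Rightarrow> real \<Rightarrow> bool" where
  "eigenvalue_of A \<mu> \<longleftrightarrow> (\<exists>v. v \<noteq> 0 \<and> A v = \<mu> *\<^sub>R v)"

text \<open>
  Non-degeneracy of a saddle is meant in the sense of the strict saddle property: the Hessian
  has a negative eigenvalue. Invertibility of the Hessian is not meant; the objective is
  invariant under \<open>(W, H, b) \<mapsto> (W U\<^sup>T, U H, b)\<close> for orthogonal \<open>U\<close>, so that
  its Hessian is singular at every critical point with \<open>(W, H) \<noteq> 0\<close>.
\<close>

definition strict_saddle :: "('a::real_inner \<Rightarrow> real) \<Rightarrow> 'a \<Rightarrow> bool" where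
  "strict_saddle f x \<longleftrightarrow>
     critical_point f x \<and> (\<exists>A. has_hessian f A x \<and> (\<exists>\<mu>. eigenvalue_of A \<mu> \<and> \<mu> < 0))"

end

theory Submission
  imports Defs
begin

text \<open>
  Let \<open>G\<close> be the gradient of the averaged loss with respect to the logit matrix \<open>W H + b 1\<^sup>T\<close>, and
  consider a critical point. If \<open>u\<^sup>T G v \<le> sqrt (lW lH) |u| |v|\<close> for all \<open>u, v\<close>, then the tangent inequality
  of the convex loss, together with AM-GM on the columns of \<open>W\<close> and the rows of \<open>H\<close>, shows that the point
  is a global minimizer. Otherwise, since \<open>d > K\<close>, there is a vector \<open>a\<close> with \<open>W a = 0\<close> and \<open>H\<^sup>T a = 0\<close>,
  and \<open>(- s u a\<^sup>T, t a v\<^sup>T, 0)\<close> is a direction of negative curvature.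

  At a minimizer, permuting classes and samples gives another minimizer, so strict convexity of
  log-sum-exp modulo constants makes the softmax outputs invariant under these permutations. Hence \<open>G\<close> is
  a multiple of \<open>I - 1 1\<^sup>T / K\<close> repeated over the samples, and the first-order conditions determine
  \<open>W\<close>, \<open>H\<close> and \<open>b\<close>.
\<close>

subsection \<open>Second derivatives and descent\<close>

text \<open>A minimizer \<open>u\<close> of the quadratic form on the unit sphere is an eigenvector
  for the minimum \<open>\<mu>\<close>, and the direction \<open>v\<close> forces
  \<open>\<mu>\<close> to be negative.\<close>

lemma symmetric_negative_eigenvalue:
  fixes A :: "'a::euclidean_space \<Rightarrow> 'a"
  assumes lin: "linear A" and sym: "\<And>x y. A x \<bullet> y = x \<bullet> A y" and descent: "v \<bullet> A v < 0"
  shows "\<exists>\<mu><0. eigenvalue_of A \<mu>"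
proof -
  interpret linear A by fact
  have v0: "v \<noteq> 0"
 using descent by auto
  have cont: "continuous_on (sphere 0 1) (\<lambda>x. x \<bullet> A x)"
    by (intro continuous_intros linear_continuous_on lin linear_conv_bounded_linear[THEN iffD1])
  have "v /\<^sub>R norm v \<in> sphere 0 1" using v0 by simp
  then have "sphere (0::'a) 1 \<noteq> {}" by blast
  then obtain u where u: "norm u = 1" and umin: "\<And>x. norm x = 1 \<Longrightarrow> u \<bullet> A u \<le> x \<bullet> A x"
    using continuous_attains_inf[OF compact_sphere _ cont] by auto
  define \<mu> where "\<mu> = u \<bullet> A u"
  have form: "\<mu> * (x \<bullet> x) \<le> x \<bullet> A x" for x
  proof (cases "x = 0")
    case False
    then have "\<mu> \<le> (x /\<^sub>R norm x) \<bullet> A (x /\<^sub>R norm x)"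
      unfolding \<mu>_def by (intro umin) simp
    also have "\<dots> = (x \<bullet> A x) / (norm x)\<^sup>2"
      by (simp add: scale power2_eq_square divide_simps)
    finally show ?thesis using False
      by (simp add: pos_le_divide_eq dot_square_norm)
  qed simp
  have "\<mu> < 0"
  proof -
    have "\<mu> * (v \<bullet> v) < 0" using form[of v] descent by simp
    then show ?thesis by (meson inner_ge_zero mult_nonneg_nonneg not_le)
  qed
  moreover have "A u = \<mu> *\<^sub>R u"
  proof -
    define r where "r = A u - \<mu> *\<^sub>R u"
    have uu: "u \<bullet> u = 1" using u by (simp add: dot_square_norm)
    define c where "c = r \<bullet> A r - \<mu> * (r \<bullet> r)"
    \<comment> \<open>The form of \<open>A - \<mu> I\<close> is nonnegative and zero at
      \<open>u\<close>, so its first variation along the residual \<open>r\<close>, which equals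
      \<open>2 (r \<bullet> r)\<close>, has to vanish.\<close>
    have quad: "0 \<le> 2 * t * (r \<bullet> r) + t\<^sup>2 * c" for t
    proof -
      have "0 \<le> (u + t *\<^sub>R r) \<bullet> A (u + t *\<^sub>R r) - \<mu> * ((u + t *\<^sub>R r) \<bullet> (u + t *\<^sub>R r))"
        using form by simp
      also have "\<dots> = (u \<bullet> A u - \<mu> * (u \<bullet> u)) + t * (u \<bullet> A r + r \<bullet> A u - 2 * \<mu> * (u \<bullet> r)) + t\<^sup>2 * c"
        by (simp add: add scale inner_simps c_def algebra_simps power2_eq_square inner_commute)
      also have "u \<bullet> A r + r \<bullet> A u - 2 * \<mu> * (u \<bullet> r) = 2 * (r \<bullet> r)"
        using sym[of u r] unfolding r_def
        by (simp add: inner_simps inner_commute algebra_simps diff scale)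
      finally show ?thesis by (simp add: \<mu>_def uu algebra_simps)
    qed
    have "r \<bullet> r = 0"
    proof (rule ccontr)
      assume "r \<bullet> r \<noteq> 0"
      then have pos: "r \<bullet> r > 0" by simp
      \<comment> \<open>Negative, and so small that the linear term dominates:
        \<open>\<bar>t * c\<bar>\<close> is at most \<open>r \<bullet> r\<close>.\<close>
      define t where "t = - (r \<bullet> r) / (\<bar>c\<bar> + 1)"
      have "\<bar>t * c\<bar> \<le> r \<bullet> r"
        using pos by (simp add: t_def abs_mult field_simps)
      then have "0 < 2 * (r \<bullet> r) + t * c" using pos by linarith
      moreover have "t < 0" using pos by (simp add: t_def divide_neg_pos)
      ultimately have "t * (2 * (r \<bullet> r) + t * c) < 0" by (simp add: mult_neg_pos)
      then show False using quad[of t] by (simp add: algebra_simps power2_eq_square)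
    qed
    then show ?thesis by (simp add: r_def)
  qed
  ultimately show ?thesis unfolding eigenvalue_of_def using u by (metis norm_zero zero_neq_one)
qed

section \<open>Functions with a symmetric second derivative\<close>

text \<open>Carrying the symmetry of the second derivative through the closure rules avoids Schwarz's theorem.\<close>

definition sym_twice_diff :: "('a::euclidean_space \<Rightarrow> real) \<Rightarrow> bool" where
  "sym_twice_diff f \<longleftrightarrow> (\<exists>g A. \<forall>x. GDERIV f x :> g x \<and> (g has_derivative A x) (at x)
     \<and> (\<forall>u v. A x u \<bullet> v = u \<bullet> A x v))"

lemma sym_twice_diff_const [intro]: "sym_twice_diff (\<lambda>x. c)"
  unfolding sym_twice_diff_def
  by (rule exI[of _ "\<lambda>x. 0"], rule exI[of _ "\<lambda>x u. 0"]) (auto simp: GDERIV_const)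

lemma sym_twice_diff_linear [intro]:
  fixes f :: "'a::euclidean_space \<Rightarrow> real"
  assumes "bounded_linear f" shows "sym_twice_diff f"
proof -
  interpret bounded_linear f by fact
  have "f x = x \<bullet> (\<Sum>b\<in>Basis. f b *\<^sub>R b)" for x
  proof -
    have "f x = f (\<Sum>b\<in>Basis. (x \<bullet> b) *\<^sub>R b)" by (simp add: euclidean_representation)
    then show ?thesis by (simp add: sum scaleR inner_sum_right mult.commute)
  qed
  then have "f = (\<lambda>x. x \<bullet> (\<Sum>b\<in>Basis. f b *\<^sub>R b))" ..
  then obtain a where f: "f = (\<lambda>x. x \<bullet> a)" ..
  show ?thesis unfolding sym_twice_diff_def f gderiv_def
    by (rule exI[of _ "\<lambda>x. a"], rule exI[of _ "\<lambda>x u. 0"]) (auto intro!: derivative_eq_intros)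
qed

lemma sym_twice_diff_add [intro]:
  assumes "sym_twice_diff f" "sym_twice_diff g" shows "sym_twice_diff (\<lambda>x. f x + g x)"
proof -
  obtain f' A g' B where
    f: "\<And>x. GDERIV f x :> f' x" "\<And>x. (f' has_derivative A x) (at x)" "\<And>x u v. A x u \<bullet> v = u \<bullet> A x v" and
    g: "\<And>x. GDERIV g x :> g' x" "\<And>x. (g' has_derivative B x) (at x)" "\<And>x u v. B x u \<bullet> v = u \<bullet> B x v"
    using assms unfolding sym_twice_diff_def by metis
  show ?thesis unfolding sym_twice_diff_def
    by (rule exI[of _ "\<lambda>x. f' x + g' x"], rule exI[of _ "\<lambda>x u. A x u + B x u"])
       (auto intro!: GDERIV_add f(1,2) g(1,2) has_derivative_add simp: inner_simps f(3) g(3))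
qed

lemma sym_twice_diff_sum [intro]:
  assumes "\<And>i. i \<in> I \<Longrightarrow> sym_twice_diff (f i)" shows "sym_twice_diff (\<lambda>x. \<Sum>i\<in>I. f i x)"
  using assms by (induction I rule: infinite_finite_induct) auto

lemma sym_twice_diff_mult [intro]:
  assumes "sym_twice_diff f" "sym_twice_diff g" shows "sym_twice_diff (\<lambda>x. f x * g x)"
proof -
  obtain f' A g' B where
    f: "\<And>x. GDERIV f x :> f' x" "\<And>x. (f' has_derivative A x) (at x)" "\<And>x u v. A x u \<bullet> v = u \<bullet> A x v" and
    g: "\<And>x. GDERIV g x :> g' x" "\<And>x. (g' has_derivative B x) (at x)" "\<And>x u v. B x u \<bullet> v = u \<bullet> B x v"
    using assms unfolding sym_twice_diff_def by metis
  have fd: "(f has_derivative (\<lambda>u. u \<bullet> f' x)) (at x)" and gd: "(g has_derivative (\<lambda>u. u \<bullet> g' x)) (at x)" for x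
    using f(1) g(1) by (auto simp: gderiv_def)
  show ?thesis unfolding sym_twice_diff_def
  proof (intro exI allI conjI)
    fix x u v
    show "GDERIV (\<lambda>x. f x * g x) x :> f x *\<^sub>R g' x + g x *\<^sub>R f' x"
      by (rule GDERIV_mult[OF f(1) g(1)])
    show "((\<lambda>x. f x *\<^sub>R g' x + g x *\<^sub>R f' x) has_derivative
        (\<lambda>u. f x *\<^sub>R B x u + (u \<bullet> f' x) *\<^sub>R g' x + (g x *\<^sub>R A x u + (u \<bullet> g' x) *\<^sub>R f' x))) (at x)"
      by (intro has_derivative_add has_derivative_scaleR fd gd f(2) g(2))
    \<comment> \<open>The two mixed rank-one terms change places when \<open>u\<close> and
      \<open>v\<close> are swapped.\<close>
    show "(f x *\<^sub>R B x u + (u \<bullet> f' x) *\<^sub>R g' x + (g x *\<^sub>R A x u + (u \<bullet> g' x) *\<^sub>R f' x)) \<bullet> v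
        = u \<bullet> (f x *\<^sub>R B x v + (v \<bullet> f' x) *\<^sub>R g' x + (g x *\<^sub>R A x v + (v \<bullet> g' x) *\<^sub>R f' x))"
      using f(3)[of x u v] g(3)[of x u v] by (simp add: inner_simps inner_commute)
  qed
qed

text \<open>The derivatives of \<open>\<phi>\<close> are asked for only at values taken by
  \<open>f\<close>, so that the rule applies to \<open>ln\<close> of a positive function.\<close>

lemma sym_twice_diff_compose:
  fixes \<phi> :: "real \<Rightarrow> real"
  assumes "sym_twice_diff f"
    and \<phi>: "\<And>x. (\<phi> has_real_derivative \<phi>' (f x)) (at (f x))"
    and \<phi>': "\<And>x. (\<phi>' has_real_derivative \<phi>'' (f x)) (at (f x))"
  shows "sym_twice_diff (\<lambda>x. \<phi> (f x))"
proof -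
  obtain f' A where
    f: "\<And>x. GDERIV f x :> f' x" "\<And>x. (f' has_derivative A x) (at x)" "\<And>x u v. A x u \<bullet> v = u \<bullet> A x v"
    using assms(1) unfolding sym_twice_diff_def by metis
  have fd: "(f has_derivative (\<lambda>u. u \<bullet> f' x)) (at x)" for x
    using f(1) by (auto simp: gderiv_def)
  have c: "((\<lambda>x. \<phi>' (f x)) has_derivative (\<lambda>u. \<phi>'' (f x) * (u \<bullet> f' x))) (at x)" for x
    using has_derivative_compose[OF fd \<phi>'[unfolded has_field_derivative_def]] by simp
  show ?thesis unfolding sym_twice_diff_def
  proof (intro exI allI conjI)
    fix x u v
    show "GDERIV (\<lambda>x. \<phi> (f x)) x :> \<phi>' (f x) *\<^sub>R f' x"
      by (rule GDERIV_DERIV_compose[OF f(1) \<phi>])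
    show "((\<lambda>x. \<phi>' (f x) *\<^sub>R f' x) has_derivative
        (\<lambda>u. \<phi>' (f x) *\<^sub>R A x u + (\<phi>'' (f x) * (u \<bullet> f' x)) *\<^sub>R f' x)) (at x)"
      by (intro has_derivative_scaleR c f(2))
    show "(\<phi>' (f x) *\<^sub>R A x u + (\<phi>'' (f x) * (u \<bullet> f' x)) *\<^sub>R f' x) \<bullet> v
        = u \<bullet> (\<phi>' (f x) *\<^sub>R A x v + (\<phi>'' (f x) * (v \<bullet> f' x)) *\<^sub>R f' x)"
      using f(3)[of x u v] by (simp add: inner_simps inner_commute)
  qed
qed

text \<open>A function of the form \<open>\<psi> (\<tau>\<^sup>2)\<close> has second derivative \<open>2 \<psi>' 0\<close> at \<open>\<tau> = 0\<close>.\<close>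

lemma negative_eigenvalue_of_quadratic_descent:
  fixes f :: "'a::euclidean_space \<Rightarrow> real"
  assumes "sym_twice_diff f"
    and eq: "\<And>\<tau>. f (x + \<tau> *\<^sub>R v) = \<psi> (\<tau>\<^sup>2)"
    and \<psi>: "\<And>s. (\<psi> has_real_derivative \<psi>' s) (at s)" and cont: "isCont \<psi>' 0" and neg: "\<psi>' 0 < 0"
  shows "\<exists>A. has_hessian f A x \<and> (\<exists>\<mu>. eigenvalue_of A \<mu> \<and> \<mu> < 0)"
proof -
  obtain g A where
    g: "\<And>x. GDERIV f x :> g x" "\<And>x. (g has_derivative A x) (at x)" "\<And>x u v. A x u \<bullet> v = u \<bullet> A x v"
    using assms(1) unfolding sym_twice_diff_def by metis
  have d1: "((\<lambda>\<tau>. f (x + \<tau> *\<^sub>R v)) has_real_derivative v \<bullet> g (x + t *\<^sub>R v)) (at t)" for t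
  proof -
    have "((\<lambda>\<tau>. x + \<tau> *\<^sub>R v) has_derivative (\<lambda>\<tau>. \<tau> *\<^sub>R v)) (at t)"
      by (auto intro!: derivative_eq_intros)
    from has_derivative_compose[OF this g(1)[unfolded gderiv_def]]
    show ?thesis by (simp add: has_field_derivative_def mult_commute_abs)
  qed
  have d2: "((\<lambda>\<tau>. f (x + \<tau> *\<^sub>R v)) has_real_derivative 2 * t * \<psi>' (t\<^sup>2)) (at t)" for t
    unfolding eq using DERIV_chain2[OF \<psi>, of "\<lambda>\<tau>. \<tau>\<^sup>2" "2 * t" t UNIV] DERIV_pow[of 2 t UNIV]
    by (simp add: mult.commute)
  \<comment> \<open>Both sides are derivatives of the same function of \<open>\<tau>\<close>, so the
    gradient along the line is expressed through \<open>\<psi>'\<close>.\<close>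
  have gv: "v \<bullet> g (x + t *\<^sub>R v) = 2 * t * \<psi>' (t\<^sup>2)" for t
    by (rule DERIV_unique[OF d1 d2])
  have "((\<lambda>\<tau>. v \<bullet> g (x + \<tau> *\<^sub>R v)) has_real_derivative v \<bullet> A x v) (at 0)"
  proof -
    have 1: "((\<lambda>\<tau>. x + \<tau> *\<^sub>R v) has_derivative (\<lambda>\<tau>. \<tau> *\<^sub>R v)) (at 0)"
      by (auto intro!: derivative_eq_intros)
    have "(g has_derivative A x) (at (x + 0 *\<^sub>R v))" using g(2) by simp
    from has_derivative_compose[OF 1 this]
    have "((\<lambda>\<tau>. v \<bullet> g (x + \<tau> *\<^sub>R v)) has_derivative (\<lambda>\<tau>. v \<bullet> A x (\<tau> *\<^sub>R v))) (at 0)"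
      by (rule has_derivative_inner_right)
    moreover have "linear (A x)" using g(2) by (rule has_derivative_linear)
    ultimately show ?thesis by (simp add: has_field_derivative_def linear_cmul mult_commute_abs)
  qed
  \<comment> \<open>The expression vanishes at \<open>t = 0\<close>, so this is its difference
    quotient there; cancelling \<open>t\<close> leaves a limit given by continuity of
    \<open>\<psi>'\<close> at \<open>0\<close>.\<close>
  then have "((\<lambda>t. (2 * t * \<psi>' (t\<^sup>2)) / t) \<longlongrightarrow> v \<bullet> A x v) (at 0)"
    unfolding gv by (simp add: DERIV_def)
  moreover have "((\<lambda>t. (2 * t * \<psi>' (t\<^sup>2)) / t) \<longlongrightarrow> 2 * \<psi>' 0) (at 0)"
  proof -
    have "isCont (\<lambda>t::real. 2 * \<psi>' (t\<^sup>2)) 0"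
      using isCont_o2[of "0::real" "\<lambda>t. t\<^sup>2" \<psi>'] cont by (auto intro!: continuous_intros)
    then have "((\<lambda>t. 2 * \<psi>' (t\<^sup>2)) \<longlongrightarrow> 2 * \<psi>' 0) (at 0)" by (simp add: isCont_def)
    then show ?thesis
      by (rule Lim_transform_eventually) (auto simp: eventually_at_filter)
  qed
  ultimately have "v \<bullet> A x v = 2 * \<psi>' 0" by (rule LIM_unique)
  then have "v \<bullet> A x v < 0" using neg by simp
  from symmetric_negative_eigenvalue[OF has_derivative_linear[OF g(2)] g(3) this]
  have "\<exists>\<mu><0. eigenvalue_of (A x) \<mu>" .
  moreover have "has_hessian f (A x) x"
    unfolding has_hessian_def using g(1,2) by (intro exI[of _ g] conjI always_eventually allI)
  ultimately show ?thesis by blast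
qed

text \<open>As \<open>\<psi>\<close> decreases just to the right of \<open>0\<close>, the points
  with \<open>\<tau> = sqrt h\<close> for small \<open>h > 0\<close> lie near \<open>x\<close> and
  have smaller value.\<close>

lemma not_local_minimizer_of_quadratic_descent:
  fixes f :: "'a::real_normed_vector \<Rightarrow> real"
  assumes eq: "\<And>\<tau>. f (x + \<tau> *\<^sub>R v) = \<psi> (\<tau>\<^sup>2)"
    and \<psi>: "(\<psi> has_real_derivative l) (at 0)" and neg: "l < 0"
  shows "\<not> local_minimizer f x"
proof
  assume "local_minimizer f x"
  moreover have "((\<lambda>\<tau>::real. x + \<tau> *\<^sub>R v) \<longlongrightarrow> x) (at 0)"
    by (auto intro!: tendsto_eq_intros)
  ultimately have "\<forall>\<^sub>F \<tau> in at 0. f x \<le> f (x + \<tau> *\<^sub>R v)"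
    unfolding local_minimizer_def by (rule eventually_compose_filterlim)
  then obtain e where e: "e > 0" "\<And>\<tau>. \<tau> \<noteq> 0 \<Longrightarrow> \<bar>\<tau>\<bar> < e \<Longrightarrow> \<psi> 0 \<le> \<psi> (\<tau>\<^sup>2)"
    using eq[of 0] by (auto simp: eventually_at eq)
  obtain d where d: "d > 0" "\<And>h. h > 0 \<Longrightarrow> h < d \<Longrightarrow> \<psi> (0 + h) < \<psi> 0"
    using DERIV_neg_dec_right[OF \<psi> neg] by auto
  define h where "h = min d (e\<^sup>2) / 2"
  have "0 < h" "h < d" "h < e\<^sup>2" using d(1) e(1) by (auto simp: h_def min_def)
  then have "sqrt h < e" using e(1) by (simp add: real_less_lsqrt)
  then show False using e(2)[of "sqrt h"] d(2)[of h] \<open>0 < h\<close> \<open>h < d\<close> by simp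
qed

subsection \<open>Log-sum-exp and softmax\<close>

definition lse :: "real^'k \<Rightarrow> real" where
  "lse z = ln (\<Sum>i\<in>UNIV. exp (z $ i))"

definition softmax :: "real^'k \<Rightarrow> real^'k" where
  "softmax z = (\<chi> j. exp (z $ j) / (\<Sum>i\<in>UNIV. exp (z $ i)))"

lemma sum_exp_pos: "0 < (\<Sum>i\<in>UNIV. exp (z $ i :: real))" for z :: "real^'k::finite"
  by (intro sum_pos) auto

text \<open>A convex function minus a linear one, so the tangent gap of the loss is that of
  \<open>lse\<close> alone.\<close>

lemma ce_loss_eq: "ce_loss z k = lse z - z $ k"
  using sum_exp_pos[of z] by (simp add: ce_loss_def lse_def ln_div)

lemma ln_softmax: "ln (softmax z $ j) = z $ j - lse z"
  using sum_exp_pos[of z] by (simp add: softmax_def lse_def ln_div)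

lemma softmax_pos: "0 < softmax z $ j"
  using sum_exp_pos[of z] by (simp add: softmax_def)

lemma sum_softmax: "(\<Sum>j\<in>UNIV. softmax z $ j) = 1"
  using sum_exp_pos[of z] by (simp add: softmax_def sum_divide_distrib[symmetric])

lemma continuous_on_softmax: "continuous_on UNIV softmax"
proof -
  have "continuous_on UNIV (\<lambda>z::real^'k::finite. exp (z $ j) / (\<Sum>i\<in>UNIV. exp (z $ i)))" for j
    by (intro continuous_intros) (auto simp: less_imp_neq[OF sum_exp_pos, symmetric])
  then show ?thesis unfolding softmax_def by (rule continuous_on_vec_lambda)
qed

lemma has_derivative_lse: "(lse has_derivative (\<lambda>h. softmax z \<bullet> h)) (at z)"
proof -
  let ?S = "\<Sum>i\<in>UNIV. exp (z $ i)"
  have e: "((\<lambda>z. exp (z $ i)) has_derivative (\<lambda>h. exp (z $ i) * h $ i)) (at z)" for i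
    by (rule has_derivative_exp[THEN has_derivative_eq_rhs])
       (auto intro!: bounded_linear.has_derivative[OF bounded_linear_vec_nth] has_derivative_ident)
  have s: "((\<lambda>z. \<Sum>i\<in>UNIV. exp (z $ i)) has_derivative (\<lambda>h. \<Sum>i\<in>UNIV. exp (z $ i) * h $ i)) (at z)"
    by (intro has_derivative_sum e)
  have "(lse has_derivative (\<lambda>h. (\<Sum>i\<in>UNIV. exp (z $ i) * h $ i) * inverse ?S)) (at z)"
    unfolding lse_def using has_derivative_ln[OF _ s] sum_exp_pos[of z] by (simp add: mult.commute)
  moreover have "(\<lambda>h. (\<Sum>i\<in>UNIV. exp (z $ i) * h $ i) * inverse ?S) = (\<lambda>h. softmax z \<bullet> h)"
    by (rule ext) (simp add: softmax_def inner_vec_def sum_distrib_left sum_distrib_right divide_inverse mult_ac)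
  ultimately show ?thesis by simp
qed

text \<open>Turns the tangent inequality for \<open>lse\<close> into an estimate of an expectation
  under the softmax weights at \<open>z\<close>.\<close>

lemma lse_diff: "lse z' - lse z = ln (\<Sum>j\<in>UNIV. softmax z $ j * exp (z' $ j - z $ j))"
proof -
  have "(\<Sum>j\<in>UNIV. softmax z $ j * exp (z' $ j - z $ j)) = (\<Sum>j\<in>UNIV. exp (z' $ j)) / (\<Sum>j\<in>UNIV. exp (z $ j))"
    by (simp add: softmax_def sum_divide_distrib exp_diff)
  then show ?thesis using sum_exp_pos[of z] sum_exp_pos[of z'] by (simp add: lse_def ln_div)
qed

text \<open>Apply \<open>exp x \<ge> 1 + x\<close> to the increments centred at their mean. Equality
  forces every increment to equal the mean, so \<open>z'\<close> is a constant shift of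
  \<open>z\<close>, and softmax does not see such shifts.\<close>

lemma
  fixes z z' :: "real^'k::finite"
  shows lse_above_tangent: "softmax z \<bullet> (z' - z) \<le> lse z' - lse z"
    and lse_tangent_eq_imp: "lse z' - lse z \<le> softmax z \<bullet> (z' - z) \<Longrightarrow> softmax z' = softmax z"
proof -
  \<comment> \<open>The mean of \<open>z' - z\<close> under the softmax weights at \<open>z\<close>;
    centring there makes the linear terms cancel.\<close>
  define m where "m = softmax z \<bullet> (z' - z)"
  define r where "r j = exp (z' $ j - z $ j - m) - (1 + (z' $ j - z $ j - m))" for j
  have r0: "0 \<le> r j" for j unfolding r_def using exp_ge_add_one_self by (simp add: le_diff_eq)
  define s where "s = (\<Sum>j\<in>UNIV. softmax z $ j * r j)"
  have "(\<Sum>j\<in>UNIV. softmax z $ j * (1 + (z' $ j - z $ j - m))) = 1"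
    using sum_softmax[of z]
    by (simp add: distrib_left sum.distrib right_diff_distrib sum_subtractf sum_distrib_right[symmetric]
        m_def inner_vec_def)
  then have sum1: "(\<Sum>j\<in>UNIV. softmax z $ j * exp (z' $ j - z $ j - m)) = 1 + s"
    by (simp add: s_def r_def right_diff_distrib sum_subtractf)
  have "lse z' - lse z = ln ((1 + s) * exp m)"
    unfolding lse_diff sum1[symmetric] by (simp add: sum_distrib_right exp_diff)
  moreover have s0: "0 \<le> s" unfolding s_def by (intro sum_nonneg mult_nonneg_nonneg r0 less_imp_le softmax_pos)
  ultimately have diff: "lse z' - lse z = ln (1 + s) + m" by (simp add: ln_mult)
  then show "softmax z \<bullet> (z' - z) \<le> lse z' - lse z" using s0 by (simp add: m_def)
  assume "lse z' - lse z \<le> softmax z \<bullet> (z' - z)"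
  then have "ln (1 + s) \<le> 0" using diff by (simp add: m_def)
  then have "s = 0" using s0 by simp
  then have "softmax z $ j * r j = 0" for j
    unfolding s_def using softmax_pos r0 by (subst (asm) sum_nonneg_eq_0_iff) (auto intro: mult_nonneg_nonneg less_imp_le)
  then have "r j = 0" for j using softmax_pos[of z j] by (metis less_irrefl mult_eq_0_iff)
  \<comment> \<open>\<open>ln y = y - 1\<close> holds only at \<open>y = 1\<close>.\<close>
  then have "ln (exp (z' $ j - z $ j - m)) = exp (z' $ j - z $ j - m) - 1" for j
    unfolding ln_exp by (simp add: r_def)
  from ln_eq_minus_one[OF exp_gt_zero this] have "z' $ j - z $ j - m = 0" for j by simp
  then have z': "z' $ j = z $ j + m" for j by (simp add: algebra_simps eq_diff_eq)
  show "softmax z' = softmax z"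
    by (simp add: softmax_def vec_eq_iff z' exp_add sum_distrib_right[symmetric])
qed

subsection \<open>First-order conditions\<close>

definition logits :: "real^'d^'k \<Rightarrow> real^('k \<times> 'n::finite)^'d \<Rightarrow> real^'k \<Rightarrow> 'k \<times> 'n \<Rightarrow> real^'k" where
  "logits W H b p = W *v column p H + b"

text \<open>For each pair \<open>p\<close> of a class and a sample this is the column of
  \<open>G\<close> at \<open>p\<close>: the gradient of the averaged loss in the logits of
  \<open>p\<close>.\<close>

definition logit_grad :: "real^'d^'k \<Rightarrow> real^('k \<times> 'n::finite)^'d \<Rightarrow> real^'k \<Rightarrow> 'k \<times> 'n \<Rightarrow> real^'k" where
  "logit_grad W H b p =
     (1 / (real CARD('k) * real CARD('n))) *\<^sub>R (softmax (logits W H b p) - axis (fst p) 1)"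

lemma ufm_obj_eq:
  fixes W :: "real^'d::finite^'k::finite" and H :: "real^('k \<times> 'n::finite)^'d"
  shows "ufm_obj lW lH lb (W, H, b) =
    1 / (real CARD('k) * real CARD('n)) * (\<Sum>p\<in>UNIV. lse (logits W H b p) - logits W H b p $ fst p)
    + lW / 2 * (W \<bullet> W) + lH / 2 * (H \<bullet> H) + lb / 2 * (b \<bullet> b)"
proof -
  have "(\<Sum>k\<in>UNIV. \<Sum>i\<in>UNIV. ce_loss (W *v column (k, i) H + b) k) =
    (\<Sum>p\<in>UNIV. lse (logits W H b p) - logits W H b p $ fst p)"
    unfolding sum.cartesian_product UNIV_Times_UNIV
    by (intro sum.cong) (auto simp: ce_loss_eq logits_def)
  then show ?thesis by (simp add: ufm_obj_def dot_square_norm)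
qed

lemma inner_columns:
  fixes H H' :: "real^'m::finite^'d::finite"
  shows "H \<bullet> H' = (\<Sum>p\<in>UNIV. column p H \<bullet> column p H')"
  unfolding inner_vec_def column_def by (simp, rule sum.swap)

lemma inner_rows: "W \<bullet> W' = (\<Sum>k\<in>UNIV. row k W \<bullet> row k W')"
  by (simp add: inner_vec_def row_def)

lemma linear_column: "linear (column p)"
  by (rule linearI) (simp_all add: column_def vec_eq_iff)

lemma has_derivative_logits:
  fixes W :: "real^'d::finite^'k::finite" and H :: "real^('k \<times> 'n::finite)^'d"
  shows "((\<lambda>(W, H, b). logits W H b p) has_derivative
    (\<lambda>(dW, dH, db). dW *v column p H + W *v column p dH + db)) (at (W, H, b))"
proof -
  have l: "bounded_linear (\<lambda>x::(real^'d^'k) \<times> (real^('k \<times> 'n)^'d) \<times> (real^'k). column p (fst (snd x)))" for p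
    by (rule linear_conv_bounded_linear[THEN iffD1], rule linearI) (simp_all add: column_def vec_eq_iff)
  have bil: "bounded_bilinear (matrix_vector_mult :: real^'d^'k \<Rightarrow> _)"
    by (rule bilinear_conv_bounded_bilinear[THEN iffD1])
       (auto simp: bilinear_def intro!: linearI simp: matrix_vector_mult_def vec_eq_iff
         sum.distrib algebra_simps sum_distrib_left)
  let ?x = "(W, H, b)"
  have d1: "(fst has_derivative fst) (at ?x)"
    by (rule bounded_linear_imp_has_derivative[OF bounded_linear_fst])
  have d2: "((\<lambda>x. column p (fst (snd x))) has_derivative (\<lambda>h. column p (fst (snd h)))) (at ?x)"
    by (rule bounded_linear_imp_has_derivative[OF l])
  have "((\<lambda>x::(real^'d^'k) \<times> (real^('k \<times> 'n)^'d) \<times> (real^'k). fst x *v column p (fst (snd x))) has_derivative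
     (\<lambda>h. W *v column p (fst (snd h)) + fst h *v column p H)) (at (W, H, b))"
    using bounded_bilinear.FDERIV[OF bil d1 d2] by simp
  then have "((\<lambda>x::(real^'d^'k) \<times> (real^('k \<times> 'n)^'d) \<times> (real^'k). fst x *v column p (fst (snd x)) + snd (snd x)) has_derivative
     (\<lambda>h. W *v column p (fst (snd h)) + fst h *v column p H + snd (snd h))) (at (W, H, b))"
    by (intro has_derivative_add bounded_linear.has_derivative[OF bounded_linear_snd] has_derivative_ident)
  then show ?thesis by (simp add: case_prod_unfold logits_def add_ac)
qed

lemma ufm_obj_has_derivative:
  fixes W :: "real^'d::finite^'k::finite" and H :: "real^('k \<times> 'n::finite)^'d"
  shows "(ufm_obj lW lH lb has_derivative (\<lambda>(dW, dH, db).
     (\<Sum>p\<in>UNIV. logit_grad W H b p \<bullet> (dW *v column p H + W *v column p dH + db))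
     + lW * (W \<bullet> dW) + lH * (H \<bullet> dH) + lb * (b \<bullet> db))) (at (W, H, b))"
proof -
  let ?z = "\<lambda>p (x::(real^'d^'k) \<times> (real^('k \<times> 'n)^'d) \<times> (real^'k)). logits (fst x) (fst (snd x)) (snd (snd x)) p"
  let ?dz = "\<lambda>p h. fst h *v column p H + W *v column p (fst (snd h)) + snd (snd h)"
  have z: "(?z p has_derivative ?dz p) (at (W, H, b))" for p
    using has_derivative_logits[where W = W and H = H and b = b and p = p] by (simp add: case_prod_unfold)
  have l: "((\<lambda>x. lse (?z p x)) has_derivative (\<lambda>h. softmax (logits W H b p) \<bullet> ?dz p h)) (at (W, H, b))" for p
    using has_derivative_compose[OF z has_derivative_lse] by simp
  have c: "((\<lambda>x. ?z p x $ fst p) has_derivative (\<lambda>h. ?dz p h $ fst p)) (at (W, H, b))" for p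
    by (rule bounded_linear.has_derivative[OF bounded_linear_vec_nth z])
  have q1: "((\<lambda>x. fst x \<bullet> fst x) has_derivative (\<lambda>h. 2 * (W \<bullet> fst h))) (at (W, H, b))"
    and q2: "((\<lambda>x. fst (snd x) \<bullet> fst (snd x)) has_derivative (\<lambda>h. 2 * (H \<bullet> fst (snd h)))) (at (W, H, b))"
    and q3: "((\<lambda>x. snd (snd x) \<bullet> snd (snd x)) has_derivative (\<lambda>h. 2 * (b \<bullet> snd (snd h)))) (at (W, H, b))"
    by (auto intro!: derivative_eq_intros simp: inner_commute)
  have f: "ufm_obj lW lH lb = (\<lambda>x::(real^'d^'k) \<times> (real^('k \<times> 'n)^'d) \<times> (real^'k).
      1 / (real CARD('k) * real CARD('n)) * (\<Sum>p\<in>UNIV. lse (?z p x) - ?z p x $ fst p)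
    + lW / 2 * (fst x \<bullet> fst x) + lH / 2 * (fst (snd x) \<bullet> fst (snd x)) + lb / 2 * (snd (snd x) \<bullet> snd (snd x)))"
    by (rule ext) (auto simp: ufm_obj_eq)
  have "(ufm_obj lW lH lb has_derivative (\<lambda>h.
     1 / (real CARD('k) * real CARD('n)) * (\<Sum>p\<in>UNIV. softmax (logits W H b p) \<bullet> ?dz p h - ?dz p h $ fst p)
     + lW / 2 * (2 * (W \<bullet> fst h)) + lH / 2 * (2 * (H \<bullet> fst (snd h))) + lb / 2 * (2 * (b \<bullet> snd (snd h))))) (at (W, H, b))"
    unfolding f by (intro has_derivative_add has_derivative_mult_right has_derivative_sum has_derivative_diff l c q1 q2 q3)
  moreover have "1 / (real CARD('k) * real CARD('n)) * (\<Sum>p\<in>UNIV. softmax (logits W H b p) \<bullet> ?dz p h - ?dz p h $ fst p)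
    = (\<Sum>p\<in>UNIV. logit_grad W H b p \<bullet> ?dz p h)" for h
    unfolding sum_distrib_left logit_grad_def inner_scaleR_left inner_diff_left inner_axis' by simp
  ultimately show ?thesis by (simp add: case_prod_unfold)
qed

text \<open>The derivative in an arbitrary direction, written out so that later proofs only choose
  \<open>dW\<close>, \<open>dH\<close> and \<open>db\<close>. Critical points and local minimizers
  both supply it.\<close>

definition stationary ::
  "real \<Rightarrow> real \<Rightarrow> real \<Rightarrow> real^'d::finite^'k::finite \<Rightarrow> real^('k \<times> 'n::finite)^'d \<Rightarrow> real^'k \<Rightarrow> bool" where
  "stationary lW lH lb W H b \<longleftrightarrow> (\<forall>dW dH db.
     (\<Sum>p\<in>UNIV. logit_grad W H b p \<bullet> (dW *v column p H + W *v column p dH + db))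
     + lW * (W \<bullet> dW) + lH * (H \<bullet> dH) + lb * (b \<bullet> db) = 0)"

lemma critical_point_imp_stationary:
  assumes "critical_point (ufm_obj lW lH lb) (W, H, b)"
  shows "stationary lW lH lb W H b"
proof -
  have "(ufm_obj lW lH lb has_derivative (\<lambda>h. 0)) (at (W, H, b))"
    using assms by (simp add: critical_point_def gderiv_def)
  from has_derivative_unique[OF ufm_obj_has_derivative this]
  show ?thesis unfolding stationary_def by (simp add: fun_eq_iff)
qed

lemma local_minimizer_imp_stationary:
  assumes "local_minimizer (ufm_obj lW lH lb) (W, H, b)"
  shows "stationary lW lH lb W H b"
proof -
  obtain S where S: "open S" "(W, H, b) \<in> S" "\<forall>y\<in>S. ufm_obj lW lH lb (W, H, b) \<le> ufm_obj lW lH lb y"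
    using assms unfolding local_minimizer_def eventually_nhds by blast
  from differential_zero_maxmin[OF S(2,1) ufm_obj_has_derivative] S(3)
  show ?thesis unfolding stationary_def by (simp add: fun_eq_iff)
qed

subsection \<open>The spectral bound on the loss gradient\<close>

text \<open>The operator norm of \<open>G\<close> is at most \<open>\<rho>\<close>, stated
  bilinearly to avoid singular values. It is two-sided because \<open>u\<close> may be replaced by
  \<open>- u\<close>.\<close>

definition spectral_bound ::
  "real \<Rightarrow> real^'d::finite^'k::finite \<Rightarrow> real^('k \<times> 'n::finite)^'d \<Rightarrow> real^'k \<Rightarrow> bool" where
  "spectral_bound \<rho> W H b \<longleftrightarrow>
     (\<forall>u v. (\<Sum>p\<in>UNIV. v $ p * (u \<bullet> logit_grad W H b p)) \<le> \<rho> * norm u * norm v)"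

text \<open>\<open>W' H'\<close> is the sum over \<open>l\<close> of the rank-one products of column
  \<open>l\<close> of \<open>W'\<close> and row \<open>l\<close> of \<open>H'\<close>. The bound
  applies to each of them, and AM-GM splits the product of norms into the two regularizers.\<close>

lemma spectral_bound_product:
  fixes W W' :: "real^'d::finite^'k::finite" and H H' :: "real^('k \<times> 'n::finite)^'d"
  assumes "spectral_bound (sqrt (lW * lH)) W H b" "0 < lW" "0 < lH"
  shows "- (\<Sum>p\<in>UNIV. logit_grad W H b p \<bullet> (W' *v column p H')) \<le> lW / 2 * (W' \<bullet> W') + lH / 2 * (H' \<bullet> H')"
proof -
  let ?G = "logit_grad W H b"
  have "?G p \<bullet> (W' *v column p H') = (\<Sum>l\<in>UNIV. H' $ l $ p * (column l W' \<bullet> ?G p))" for p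
    unfolding matrix_mult_sum inner_sum_right
    by (simp add: column_def inner_commute scalar_mult_eq_scaleR)
  then have "- (\<Sum>p\<in>UNIV. ?G p \<bullet> (W' *v column p H'))
      = (\<Sum>l\<in>UNIV. \<Sum>p\<in>UNIV. H' $ l $ p * (- column l W' \<bullet> ?G p))"
    by (simp add: sum_negf sum.swap[of _ "UNIV :: 'd set"])
  also have "\<dots> \<le> (\<Sum>l\<in>UNIV. lW / 2 * (column l W' \<bullet> column l W') + lH / 2 * (H' $ l \<bullet> H' $ l))"
  proof (rule sum_mono)
    fix l
    let ?w = "norm (column l W')" and ?h = "norm (H' $ l)"
    have "(\<Sum>p\<in>UNIV. H' $ l $ p * (- column l W' \<bullet> ?G p)) \<le> sqrt (lW * lH) * norm (- column l W') * ?h"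
      using assms(1) unfolding spectral_bound_def by blast
    also have "\<dots> = (sqrt lW * ?w) * (sqrt lH * ?h)" by (simp add: real_sqrt_mult)
    also have "\<dots> \<le> (sqrt lW * ?w)\<^sup>2 / 2 + (sqrt lH * ?h)\<^sup>2 / 2"
      using sum_squares_bound[of "sqrt lW * ?w" "sqrt lH * ?h"] by simp
    finally show "(\<Sum>p\<in>UNIV. H' $ l $ p * (- column l W' \<bullet> ?G p))
        \<le> lW / 2 * (column l W' \<bullet> column l W') + lH / 2 * (H' $ l \<bullet> H' $ l)"
      using assms(2,3) by (simp add: power_mult_distrib dot_square_norm)
  qed
  also have "\<dots> = lW / 2 * (W' \<bullet> W') + lH / 2 * (H' \<bullet> H')"
    unfolding inner_columns[of W' W'] inner_vec_def[of H' H']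
    by (simp add: sum.distrib sum_distrib_left)
  finally show ?thesis .
qed

text \<open>Stationarity makes the regularizer of \<open>(W, H)\<close> equal to minus the pairing
  of \<open>G\<close> with \<open>W H\<close>, while the spectral bound makes the regularizer of
  \<open>(W', H')\<close> at least minus the pairing with \<open>W' H'\<close>. What remains is the
  Bregman divergence of \<open>lse\<close>; keeping it, rather than only its sign, serves the
  equality case too.\<close>

lemma ufm_obj_gap:
  fixes W W' :: "real^'d::finite^'k::finite" and H H' :: "real^('k \<times> 'n::finite)^'d"
  assumes st: "stationary lW lH lb W H b" and sp: "spectral_bound (sqrt (lW * lH)) W H b"
    and pos: "0 < lW" "0 < lH" "0 \<le> lb"
  shows "1 / (real CARD('k) * real CARD('n)) * (\<Sum>p\<in>UNIV. lse (logits W' H' b' p) - lse (logits W H b p)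
      - softmax (logits W H b p) \<bullet> (logits W' H' b' p - logits W H b p))
    \<le> ufm_obj lW lH lb (W', H', b') - ufm_obj lW lH lb (W, H, b)"
proof -
  let ?G = "logit_grad W H b" and ?z = "logits W H b" and ?z' = "logits W' H' b'"
  let ?c = "1 / (real CARD('k) * real CARD('n))"
  \<comment> \<open>Test stationarity with the point's own \<open>W\<close>, then \<open>H\<close>,
    then with the bias increment.\<close>
  have eW: "(\<Sum>p\<in>UNIV. ?G p \<bullet> (W *v column p H)) + lW * (W \<bullet> W) = 0"
    using st[unfolded stationary_def, rule_format, of W 0 0] by (simp add: linear_0[OF linear_column])
  have eH: "(\<Sum>p\<in>UNIV. ?G p \<bullet> (W *v column p H)) + lH * (H \<bullet> H) = 0"
    using st[unfolded stationary_def, rule_format, of 0 H 0] by simp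
  have eb: "(\<Sum>p\<in>UNIV. ?G p \<bullet> (b' - b)) + lb * (b \<bullet> (b' - b)) = 0"
    using st[unfolded stationary_def, rule_format, of 0 0 "b' - b"] by (simp add: linear_0[OF linear_column])
  have "?c * (\<Sum>p\<in>UNIV. lse (?z' p) - lse (?z p) - softmax (?z p) \<bullet> (?z' p - ?z p))
     = ?c * (\<Sum>p\<in>UNIV. lse (?z' p) - ?z' p $ fst p) - ?c * (\<Sum>p\<in>UNIV. lse (?z p) - ?z p $ fst p)
       - (\<Sum>p\<in>UNIV. ?G p \<bullet> (?z' p - ?z p))"
    unfolding sum_distrib_left sum_subtractf[symmetric] logit_grad_def inner_scaleR_left inner_diff_left inner_axis'
    by (intro sum.cong refl) (simp add: algebra_simps)
  moreover have "(\<Sum>p\<in>UNIV. ?G p \<bullet> (?z' p - ?z p))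
     = (\<Sum>p\<in>UNIV. ?G p \<bullet> (W' *v column p H')) - (\<Sum>p\<in>UNIV. ?G p \<bullet> (W *v column p H)) + (\<Sum>p\<in>UNIV. ?G p \<bullet> (b' - b))"
    unfolding logits_def by (simp add: inner_simps sum.distrib sum_subtractf)
  moreover have "lb / 2 * (b' \<bullet> b') - lb / 2 * (b \<bullet> b) - lb * (b \<bullet> (b' - b)) = lb / 2 * ((b' - b) \<bullet> (b' - b))"
    by (simp add: inner_simps inner_commute algebra_simps)
  moreover have "0 \<le> lb / 2 * ((b' - b) \<bullet> (b' - b))" using pos(3) by simp
  moreover note spectral_bound_product[OF sp pos(1,2), of W' H'] eW eH eb
  ultimately show ?thesis unfolding ufm_obj_eq by linarith
qed

lemma stationary_spectral_bound_imp_global_minimizer: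
  fixes W :: "real^'d::finite^'k::finite" and H :: "real^('k \<times> 'n::finite)^'d"
  assumes "stationary lW lH lb W H b" "spectral_bound (sqrt (lW * lH)) W H b" "0 < lW" "0 < lH" "0 \<le> lb"
  shows "global_minimizer (ufm_obj lW lH lb) (W, H, b)"
  unfolding global_minimizer_def
proof
  fix y :: "(real^'d^'k) \<times> (real^('k \<times> 'n)^'d) \<times> (real^'k)"
  obtain W' H' b' where y: "y = (W', H', b')" by (cases y)
  have "0 \<le> ufm_obj lW lH lb (W', H', b') - ufm_obj lW lH lb (W, H, b)"
    by (rule order_trans[OF _ ufm_obj_gap[OF assms]])
       (intro mult_nonneg_nonneg sum_nonneg, auto simp: lse_above_tangent)
  then show "ufm_obj lW lH lb (W, H, b) \<le> ufm_obj lW lH lb y" by (simp add: y)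
qed

section \<open>Directions of negative curvature\<close>

lemma wide_matrix_null_vector:
  fixes W :: "real^'d::finite^'k::finite"
  assumes "CARD('k) < CARD('d)"
  obtains a where "a \<noteq> 0" "W *v a = 0"
proof -
  have "\<not> inj ((*v) W)"
  proof
    assume "inj ((*v) W)"
    then have "dim (range ((*v) W)) = CARD('d)"
      using dim_image_eq[of "(*v) W" UNIV] by (simp add: matrix_vector_mul_linear)
    then show False using dim_subset_UNIV[of "range ((*v) W)"] assms by simp
  qed
  then obtain x y where "x \<noteq> y" "W *v x = W *v y" unfolding inj_def by blast
  then show thesis by (intro that[of "x - y"]) (auto simp: matrix_vector_mult_diff_distrib)
qed

text \<open>
  The direction perturbs \<open>W\<close> by \<open>- s u a\<^sup>T\<close> and \<open>H\<close> by \<open>t a v\<^sup>T\<close>, where \<open>a\<close> is a null vector of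
  both \<open>W\<close> and \<open>H\<^sup>T\<close>: the product \<open>W H\<close> then changes only at second order, by \<open>- s t |a|\<^sup>2 u v\<^sup>T\<close>.
\<close>

lemma quadratic_descent_direction:
  fixes W :: "real^'d::finite^'k::finite" and H :: "real^('k \<times> 'n::finite)^'d"
  assumes st: "stationary lW lH lb W H b" and sp: "\<not> spectral_bound (sqrt (lW * lH)) W H b"
    and pos: "0 < lW" "0 < lH" and card: "CARD('k) < CARD('d)"
  obtains D \<psi> \<psi>' where "\<And>\<tau>. ufm_obj lW lH lb ((W, H, b) + \<tau> *\<^sub>R D) = \<psi> (\<tau>\<^sup>2)"
    "\<And>s. (\<psi> has_real_derivative \<psi>' s) (at s)" "isCont \<psi>' 0" "\<psi>' 0 < 0"
proof -
  let ?G = "logit_grad W H b" and ?z = "logits W H b"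
  let ?c = "1 / (real CARD('k) * real CARD('n))"
  define \<rho> where "\<rho> = sqrt (lW * lH)"
  have \<rho>: "0 < \<rho>" using pos by (simp add: \<rho>_def)
  obtain u v where uv: "\<rho> * norm u * norm v < (\<Sum>p\<in>UNIV. v $ p * (u \<bullet> ?G p))"
    using sp unfolding spectral_bound_def \<rho>_def by (metis not_le)
  define S where "S = (\<Sum>p\<in>UNIV. v $ p * (u \<bullet> ?G p))"
  have "u \<noteq> 0" "v \<noteq> 0" using uv by auto
  obtain a where a: "a \<noteq> 0" "W *v a = 0" using wide_matrix_null_vector[OF card] .
  have aH: "a \<bullet> column p H = 0" for p
  proof -
    \<comment> \<open>The direction \<open>a a^T H\<close> is annihilated by \<open>W\<close>, so
      stationarity leaves only the regularizer, a multiple of the sum of the squares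
      \<open>(a \<bullet> column p H)^2\<close>.\<close>
    define dH :: "real^('k \<times> 'n)^'d" where "dH = (\<chi> l p. (a \<bullet> column p H) * a $ l)"
    have col: "column p dH = (a \<bullet> column p H) *\<^sub>R a" for p
      by (simp add: dH_def column_def vec_eq_iff)
    have "W *v column p dH = 0" for p unfolding col by (simp add: a(2) matrix_vector_mult_scaleR)
    then have "lH * (H \<bullet> dH) = 0"
      using st[unfolded stationary_def, rule_format, of 0 dH 0] by simp
    then have "(\<Sum>p\<in>UNIV. (a \<bullet> column p H)\<^sup>2) = 0"
      using pos(2) unfolding inner_columns col by (simp add: power2_eq_square inner_commute)
    then show ?thesis by (cases p) (simp add: sum_nonneg_eq_0_iff)
  qed
  \<comment> \<open>These weights make AM-GM tight: \<open>s * t = \<rho> * norm u * norm v\<close>,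
    and both regularizers contribute equally.\<close>
  define s where "s = sqrt lH * norm v"
  define t where "t = sqrt lW * norm u"
  define dW :: "real^'d^'k" where "dW = (\<chi> k l. - (s * u $ k * a $ l))"
  define dH :: "real^('k \<times> 'n)^'d" where "dH = (\<chi> l p. t * v $ p * a $ l)"
  have dWv: "dW *v x = (- (s * (a \<bullet> x))) *\<^sub>R u" for x
    by (simp add: dW_def matrix_vector_mult_def vec_eq_iff inner_vec_def sum_distrib_left sum_distrib_right
        sum_negf mult_ac)
  have colH: "column p dH = (t * v $ p) *\<^sub>R a" for p
    by (simp add: dH_def column_def vec_eq_iff)
  have rowW: "row k dW = (- (s * u $ k)) *\<^sub>R a" for k
    by (simp add: dW_def row_def vec_eq_iff)
  have rWa: "row k W \<bullet> a = 0" for k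
    using a(2) by (simp add: vec_eq_iff matrix_vector_mult_def row_def inner_vec_def)
  have n: "W \<bullet> dW = 0" "H \<bullet> dH = 0" "dW \<bullet> dW = s\<^sup>2 * (u \<bullet> u) * (a \<bullet> a)" "dH \<bullet> dH = t\<^sup>2 * (v \<bullet> v) * (a \<bullet> a)"
       apply (simp add: inner_rows rowW rWa)
      apply (simp add: inner_columns[of H] colH aH inner_commute[of _ a])
     apply (simp add: inner_rows[of dW] rowW inner_vec_def[of u] sum_distrib_left sum_distrib_right power2_eq_square mult_ac)
    apply (simp add: inner_columns[of dH] colH inner_vec_def[of v] sum_distrib_left sum_distrib_right power2_eq_square mult_ac)
    done
  define m where "m p = (- (s * t * v $ p * (a \<bullet> a))) *\<^sub>R u" for p
  have z: "logits (W + \<tau> *\<^sub>R dW) (H + \<tau> *\<^sub>R dH) b p = ?z p + \<tau>\<^sup>2 *\<^sub>R m p" for \<tau> p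
  proof -
    have "(W + \<tau> *\<^sub>R dW) *v column p (H + \<tau> *\<^sub>R dH) =
        W *v column p H + (\<tau> * (t * v $ p)) *\<^sub>R (W *v a) + \<tau> *\<^sub>R (dW *v column p H)
        + (\<tau> * \<tau> * (t * v $ p)) *\<^sub>R (dW *v a)"
      unfolding linear_add[OF linear_column] linear_cmul[OF linear_column] colH
      by (simp add: matrix_vector_mult_add_rdistrib matrix_vector_right_distrib matrix_vector_mult_scaleR
          scaleR_matrix_vector_assoc[symmetric] scaleR_right_distrib mult_ac)
    then show ?thesis by (simp add: logits_def a(2) dWv aH m_def power2_eq_square mult_ac)
  qed
  \<comment> \<open>\<open>\<sigma>\<close> stands for \<open>\<tau>^2\<close>: the logits move by
    \<open>\<tau>^2\<close> times \<open>m p\<close>, and the orthogonality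
    \<open>W \<bullet> dW = H \<bullet> dH = 0\<close> removes the terms linear in
    \<open>\<tau>\<close>.\<close>
  define \<psi> where "\<psi> \<sigma> = ?c * (\<Sum>p\<in>UNIV. lse (?z p + \<sigma> *\<^sub>R m p) - (?z p + \<sigma> *\<^sub>R m p) $ fst p)
    + lW / 2 * (W \<bullet> W + \<sigma> * (dW \<bullet> dW)) + lH / 2 * (H \<bullet> H + \<sigma> * (dH \<bullet> dH)) + lb / 2 * (b \<bullet> b)" for \<sigma>
  define \<psi>' where "\<psi>' \<sigma> = ?c * (\<Sum>p\<in>UNIV. softmax (?z p + \<sigma> *\<^sub>R m p) \<bullet> m p - m p $ fst p)
    + lW / 2 * (dW \<bullet> dW) + lH / 2 * (dH \<bullet> dH)" for \<sigma>
  show thesis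
  proof (rule that[of "(dW, dH, 0)" \<psi> \<psi>'])
    show "ufm_obj lW lH lb ((W, H, b) + \<tau> *\<^sub>R (dW, dH, 0)) = \<psi> (\<tau>\<^sup>2)" for \<tau>
    proof -
      have "(W + \<tau> *\<^sub>R dW) \<bullet> (W + \<tau> *\<^sub>R dW) = W \<bullet> W + \<tau>\<^sup>2 * (dW \<bullet> dW)"
        "(H + \<tau> *\<^sub>R dH) \<bullet> (H + \<tau> *\<^sub>R dH) = H \<bullet> H + \<tau>\<^sup>2 * (dH \<bullet> dH)"
        using n(1,2) by (simp_all add: inner_simps inner_commute power2_eq_square mult_ac)
      then show ?thesis by (simp add: ufm_obj_eq z \<psi>_def)
    qed
  next
    fix \<sigma>
    have "((\<lambda>\<sigma>. lse (?z p + \<sigma> *\<^sub>R m p)) has_real_derivative softmax (?z p + \<sigma> *\<^sub>R m p) \<bullet> m p) (at \<sigma>)" for p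
    proof -
      have "((\<lambda>\<sigma>. ?z p + \<sigma> *\<^sub>R m p) has_derivative (\<lambda>\<sigma>. \<sigma> *\<^sub>R m p)) (at \<sigma>)"
        by (auto intro!: derivative_eq_intros)
      from has_derivative_compose[OF this has_derivative_lse]
      show ?thesis by (simp add: has_field_derivative_def mult_commute_abs)
    qed
    moreover have "((\<lambda>\<sigma>. (?z p + \<sigma> *\<^sub>R m p) $ fst p) has_real_derivative m p $ fst p) (at \<sigma>)" for p
      by (auto intro!: derivative_eq_intros)
    moreover have "((\<lambda>\<sigma>. W \<bullet> W + \<sigma> * (dW \<bullet> dW)) has_real_derivative dW \<bullet> dW) (at \<sigma>)"
      "((\<lambda>\<sigma>. H \<bullet> H + \<sigma> * (dH \<bullet> dH)) has_real_derivative dH \<bullet> dH) (at \<sigma>)"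
      by (auto intro!: derivative_eq_intros)
    \<comment> \<open>The trailing \<open>0\<close> is the derivative of the constant bias
      term.\<close>
    ultimately have "(\<psi> has_real_derivative \<psi>' \<sigma> + 0) (at \<sigma>)"
      unfolding \<psi>_def \<psi>'_def by (intro DERIV_add DERIV_cmult DERIV_sum DERIV_diff DERIV_const)
    then show "(\<psi> has_real_derivative \<psi>' \<sigma>) (at \<sigma>)" by simp
  next
    have "continuous_on UNIV \<psi>'" unfolding \<psi>'_def
      by (intro continuous_intros continuous_on_compose2[OF continuous_on_softmax]) auto
    then show "isCont \<psi>' 0" by (simp add: continuous_on_eq_continuous_at)
  next
    have "?c * (\<Sum>p\<in>UNIV. softmax (?z p) \<bullet> m p - m p $ fst p) = (\<Sum>p\<in>UNIV. ?G p \<bullet> m p)"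
      unfolding sum_distrib_left logit_grad_def inner_scaleR_left inner_diff_left inner_axis' by simp
    also have "\<dots> = - (s * t * (a \<bullet> a) * S)"
      unfolding S_def m_def sum_distrib_left sum_negf[symmetric]
      by (intro sum.cong) (auto simp: inner_commute mult_ac)
    finally have "\<psi>' 0 = - (s * t * (a \<bullet> a) * S) + (lW / 2 * (dW \<bullet> dW) + lH / 2 * (dH \<bullet> dH))"
      by (simp add: \<psi>'_def)
    also have "lW / 2 * (dW \<bullet> dW) + lH / 2 * (dH \<bullet> dH) = (lW * lH) * (norm u)\<^sup>2 * (norm v)\<^sup>2 * (a \<bullet> a)"
      unfolding n(3,4) s_def t_def using pos by (simp add: power_mult_distrib dot_square_norm)
    also have "lW * lH = \<rho>\<^sup>2" using pos by (simp add: \<rho>_def)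
    also have "s * t = \<rho> * norm u * norm v" by (simp add: s_def t_def \<rho>_def real_sqrt_mult)
    \<comment> \<open>The last factor is negative precisely because \<open>u\<close>,
      \<open>v\<close> violate the spectral bound.\<close>
    finally have "\<psi>' 0 = \<rho> * norm u * norm v * (a \<bullet> a) * (\<rho> * norm u * norm v - S)"
      by (simp add: algebra_simps power2_eq_square)
    moreover have "0 < \<rho> * norm u * norm v * (a \<bullet> a)" using \<rho> \<open>u \<noteq> 0\<close> \<open>v \<noteq> 0\<close> a(1) by simp
    moreover have "\<rho> * norm u * norm v - S < 0" using uv by (simp add: S_def)
    ultimately show "\<psi>' 0 < 0" by (simp add: mult_pos_neg)
  qed
qed

section \<open>Second-order regularity of the objective\<close>

lemma sym_twice_diff_inner_self:
  fixes L :: "'a::euclidean_space \<Rightarrow> 'b::euclidean_space"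
  assumes "bounded_linear L" shows "sym_twice_diff (\<lambda>x. L x \<bullet> L x)"
proof -
  have "(\<lambda>x. L x \<bullet> L x) = (\<lambda>x. \<Sum>i\<in>Basis. (L x \<bullet> i) * (L x \<bullet> i))"
    by (rule ext, rule euclidean_inner)
  moreover have "sym_twice_diff (\<lambda>x. \<Sum>i\<in>Basis. (L x \<bullet> i) * (L x \<bullet> i))"
    by (intro sym_twice_diff_sum sym_twice_diff_mult sym_twice_diff_linear
        bounded_linear_compose[OF bounded_linear_inner_left assms])
  ultimately show ?thesis by simp
qed

lemma sym_twice_diff_lse:
  assumes "\<And>i. sym_twice_diff (\<lambda>x. z x $ i)" shows "sym_twice_diff (\<lambda>x. lse (z x))"
  unfolding lse_def
proof (rule sym_twice_diff_compose[where \<phi> = ln and \<phi>' = inverse and \<phi>'' = "\<lambda>y. - (inverse y ^ Suc (Suc 0))"])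
  show "sym_twice_diff (\<lambda>x. \<Sum>i\<in>UNIV. exp (z x $ i))"
    by (rule sym_twice_diff_sum, rule sym_twice_diff_compose[OF assms DERIV_exp DERIV_exp])
  fix x
  note pos = sum_exp_pos[of "z x"]
  show "(ln has_real_derivative inverse (\<Sum>i\<in>UNIV. exp (z x $ i))) (at (\<Sum>i\<in>UNIV. exp (z x $ i)))"
    using pos by (rule DERIV_ln)
  show "(inverse has_real_derivative - (inverse (\<Sum>i\<in>UNIV. exp (z x $ i)) ^ Suc (Suc 0))) (at (\<Sum>i\<in>UNIV. exp (z x $ i)))"
    using pos by (intro DERIV_inverse) simp
qed

lemma sym_twice_diff_ufm_obj:
  "sym_twice_diff (ufm_obj lW lH lb :: (real^'d::finite^'k::finite) \<times> (real^('k \<times> 'n::finite)^'d) \<times> (real^'k) \<Rightarrow> real)"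
proof -
  have lin: "bounded_linear (\<lambda>x::(real^'d^'k) \<times> (real^('k \<times> 'n)^'d) \<times> (real^'k). fst x)"
    "bounded_linear (\<lambda>x::(real^'d^'k) \<times> (real^('k \<times> 'n)^'d) \<times> (real^'k). fst (snd x))"
    "bounded_linear (\<lambda>x::(real^'d^'k) \<times> (real^('k \<times> 'n)^'d) \<times> (real^'k). snd (snd x))"
    by (intro bounded_linear_intros)+
  let ?z = "\<lambda>p (x::(real^'d^'k) \<times> (real^('k \<times> 'n)^'d) \<times> (real^'k)). logits (fst x) (fst (snd x)) (snd (snd x)) p"
  have z: "sym_twice_diff (\<lambda>x. ?z p x $ i)" for p i
  proof -
    have "?z p x $ i = (\<Sum>l\<in>UNIV. fst x $ i $ l * fst (snd x) $ l $ p) + snd (snd x) $ i" for x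
      by (simp add: logits_def matrix_vector_mult_def column_def)
    moreover have "sym_twice_diff (\<lambda>x::(real^'d^'k) \<times> (real^('k \<times> 'n)^'d) \<times> (real^'k).
        (\<Sum>l\<in>UNIV. fst x $ i $ l * fst (snd x) $ l $ p) + snd (snd x) $ i)"
      by (intro sym_twice_diff_add sym_twice_diff_sum sym_twice_diff_mult
          sym_twice_diff_linear[OF bounded_linear_compose[OF bounded_linear_vec_nth lin(3)]]
          sym_twice_diff_linear[OF bounded_linear_compose[OF bounded_linear_vec_nth
              bounded_linear_compose[OF bounded_linear_vec_nth lin(1)]]]
          sym_twice_diff_linear[OF bounded_linear_compose[OF bounded_linear_vec_nth
              bounded_linear_compose[OF bounded_linear_vec_nth lin(2)]]])
    ultimately show ?thesis by simp
  qed
  \<comment> \<open>The difference is written with a factor \<open>- 1\<close> to fit the closure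
    rules for sums and products.\<close>
  have f: "ufm_obj lW lH lb = (\<lambda>x::(real^'d^'k) \<times> (real^('k \<times> 'n)^'d) \<times> (real^'k).
      1 / (real CARD('k) * real CARD('n)) * (\<Sum>p\<in>UNIV. lse (?z p x) + (- 1) * ?z p x $ fst p)
    + lW / 2 * (fst x \<bullet> fst x) + lH / 2 * (fst (snd x) \<bullet> fst (snd x)) + lb / 2 * (snd (snd x) \<bullet> snd (snd x)))"
    by (rule ext) (auto simp: ufm_obj_eq)
  have "sym_twice_diff (\<lambda>x. lse (?z p x) + (- 1) * ?z p x $ fst p)" for p
    by (rule sym_twice_diff_add[OF sym_twice_diff_lse[OF z] sym_twice_diff_mult[OF sym_twice_diff_const z]])
  note * = sym_twice_diff_sum[OF this]
  show ?thesis unfolding f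
    by (rule sym_twice_diff_add sym_twice_diff_mult[OF sym_twice_diff_const] * sym_twice_diff_inner_self lin)+
qed

subsection \<open>Symmetry and the structure of minimizers\<close>

text \<open>Relabelling the classes by \<open>\<sigma>\<close> keeps every feature with its own
  label because \<open>\<pi>\<close> moves the class component by the same \<open>\<sigma>\<close>;
  all sums are merely reindexed.\<close>

lemma ufm_obj_permute:
  fixes W :: "real^'d::finite^'k::finite" and H :: "real^('k \<times> 'n::finite)^'d" and b :: "real^'k"
    and \<sigma> :: "'k \<Rightarrow> 'k" and \<pi> :: "'k \<times> 'n \<Rightarrow> 'k \<times> 'n"
  assumes \<sigma>: "bij \<sigma>" and \<pi>: "bij \<pi>" and fst: "\<And>p. fst (\<pi> p) = \<sigma> (fst p)"
  defines "W' \<equiv> \<chi> k. W $ \<sigma> k" and "H' \<equiv> \<chi> l p. H $ l $ \<pi> p" and "b' \<equiv> \<chi> k. b $ \<sigma> k"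
  shows logits_permute: "logits W' H' b' p $ j = logits W H b (\<pi> p) $ \<sigma> j"
    and "ufm_obj lW lH lb (W', H', b') = ufm_obj lW lH lb (W, H, b)"
proof -
  show l: "logits W' H' b' p $ j = logits W H b (\<pi> p) $ \<sigma> j" for p j
    by (simp add: logits_def matrix_vector_mult_def column_def W'_def H'_def b'_def)
  note r\<sigma> = sum.reindex_bij_betw[OF \<sigma>] and r\<pi> = sum.reindex_bij_betw[OF \<pi>]
  have "lse (logits W' H' b' p) = lse (logits W H b (\<pi> p))" for p
    unfolding lse_def l using r\<sigma>[of "\<lambda>j. exp (logits W H b (\<pi> p) $ j)"] by simp
  then have "(\<Sum>p\<in>UNIV. lse (logits W' H' b' p) - logits W' H' b' p $ fst p)
      = (\<Sum>p\<in>UNIV. lse (logits W H b p) - logits W H b p $ fst p)"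
    unfolding l using r\<pi>[of "\<lambda>p. lse (logits W H b p) - logits W H b p $ fst p"] by (simp add: fst)
  moreover have "W' \<bullet> W' = W \<bullet> W"
    using r\<sigma>[of "\<lambda>k. W $ k \<bullet> W $ k"] unfolding inner_vec_def[of W' W'] inner_vec_def[of W W] by (simp add: W'_def)
  moreover have "H' $ l \<bullet> H' $ l = H $ l \<bullet> H $ l" for l
    using r\<pi>[of "\<lambda>p. H $ l $ p * H $ l $ p"] unfolding inner_vec_def by (simp add: H'_def)
  then have "H' \<bullet> H' = H \<bullet> H" by (simp add: inner_vec_def[of H' H'] inner_vec_def[of H H])
  moreover have "b' \<bullet> b' = b \<bullet> b"
    using r\<sigma>[of "\<lambda>k. b $ k * b $ k"] unfolding inner_vec_def by (simp add: b'_def)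
  ultimately show "ufm_obj lW lH lb (W', H', b') = ufm_obj lW lH lb (W, H, b)"
    by (simp add: ufm_obj_eq)
qed

text \<open>The relabelled point has the same objective value, so every divergence in the gap
  inequality is zero, and the equality case of the tangent inequality identifies the softmax
  outputs.\<close>

lemma softmax_permute:
  fixes W :: "real^'d::finite^'k::finite" and H :: "real^('k \<times> 'n::finite)^'d"
  assumes st: "stationary lW lH lb W H b" and sp: "spectral_bound (sqrt (lW * lH)) W H b"
    and pos: "0 < lW" "0 < lH" "0 \<le> lb"
    and \<sigma>: "bij \<sigma>" and \<pi>: "bij \<pi>" and fst: "\<And>p. fst (\<pi> p) = \<sigma> (fst p)"
  shows "softmax (logits W H b (\<pi> p)) $ \<sigma> j = softmax (logits W H b p) $ j"
proof -
  define W' :: "real^'d^'k" where "W' = (\<chi> k. W $ \<sigma> k)"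
  define H' :: "real^('k \<times> 'n)^'d" where "H' = (\<chi> l p. H $ l $ \<pi> p)"
  define b' :: "real^'k" where "b' = (\<chi> k. b $ \<sigma> k)"
  note perm = ufm_obj_permute[OF \<sigma> \<pi> fst, where W = W and H = H and b = b, folded W'_def H'_def b'_def]
  define e where "e p = lse (logits W' H' b' p) - lse (logits W H b p)
      - softmax (logits W H b p) \<bullet> (logits W' H' b' p - logits W H b p)" for p
  have e0: "0 \<le> e p" for p using lse_above_tangent by (simp add: e_def)
  have "(\<Sum>p\<in>UNIV. e p) \<le> 0"
    using ufm_obj_gap[OF st sp pos, of W' H' b'] perm(2) by (simp add: e_def mult_le_0_iff divide_le_0_iff)
  then have "(\<Sum>p\<in>UNIV. e p) = 0" using e0 by (simp add: antisym sum_nonneg)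
  then have "e p = 0" using e0 by (cases p) (simp add: sum_nonneg_eq_0_iff)
  then have eq: "softmax (logits W' H' b' p) = softmax (logits W H b p)"
    by (intro lse_tangent_eq_imp) (simp add: e_def)
  have "(\<Sum>i\<in>UNIV. exp (logits W H b (\<pi> p) $ \<sigma> i)) = (\<Sum>i\<in>UNIV. exp (logits W H b (\<pi> p) $ i))"
    using sum.reindex_bij_betw[OF \<sigma>, of "\<lambda>i. exp (logits W H b (\<pi> p) $ i)"] .
  then show ?thesis unfolding eq[symmetric] by (simp add: softmax_def perm(1))
qed

text \<open>Move \<open>a\<close> to \<open>c\<close> by a transposition, then the image of
  \<open>b\<close> to \<open>d\<close> by a second one; the second fixes \<open>c\<close>, as
  \<open>c\<close> is neither that image nor \<open>d\<close>.\<close>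

lemma exists_bij_map_pair:
  assumes "a \<noteq> b" "c \<noteq> d"
  obtains \<sigma> :: "'a \<Rightarrow> 'a" where "bij \<sigma>" "\<sigma> a = c" "\<sigma> b = d"
proof
  let ?s = "Transposition.transpose (Transposition.transpose a c b) d \<circ> Transposition.transpose a c"
  show "bij ?s" by (intro bij_comp bij_transpose)
  show "?s a = c" "?s b = d" using assms by (auto simp: Transposition.transpose_def)
qed

text \<open>Relabellings act transitively on triples of two distinct classes and a sample, so all
  off-diagonal outputs share one value; the diagonal ones follow since the outputs sum to
  \<open>1\<close>.\<close>

lemma softmax_two_valued:
  fixes W :: "real^'d::finite^'k::finite" and H :: "real^('k \<times> 'n::finite)^'d"
  assumes "stationary lW lH lb W H b" "spectral_bound (sqrt (lW * lH)) W H b"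
    and "0 < lW" "0 < lH" "0 \<le> lb" and K: "2 \<le> CARD('k)"
  obtains q where "0 < q" "\<And>k i j. softmax (logits W H b (k, i)) $ j = (if j = k then 1 - (real CARD('k) - 1) * q else q)"
proof -
  let ?s = "\<lambda>k i j. softmax (logits W H b (k, i)) $ j"
  have inv: "?s (\<sigma> k) (\<tau> i) (\<sigma> j) = ?s k i j" if "bij \<sigma>" "bij \<tau>" for \<sigma> \<tau> k i j
  proof -
    have "bij (map_prod \<sigma> \<tau>)"
      using that by (simp add: bij_def prod.inj_map map_prod_surj)
    from softmax_permute[OF assms(1-5) that(1) this, of "(k, i)" j] show ?thesis by simp
  qed
  have "\<not> is_singleton (UNIV :: 'k set)" using K by (simp add: is_singleton_altdef)
  then obtain k0 j0 :: 'k where kj: "k0 \<noteq> j0" by (metis UNIV_I is_singletonI' empty_not_UNIV)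
  obtain i0 :: 'n where True by blast
  define q where "q = ?s k0 i0 j0"
  have off: "?s k i j = q" if jk: "k \<noteq> j" for k i j
  proof -
    obtain \<sigma> where "bij \<sigma>" "\<sigma> k0 = k" "\<sigma> j0 = j" using exists_bij_map_pair[OF kj jk] .
    then show ?thesis
      using inv[of \<sigma> "Transposition.transpose i0 i" k0 i0 j0] by (simp add: q_def)
  qed
  have "?s k i k = 1 - (real CARD('k) - 1) * q" for k i
  proof -
    have "1 = ?s k i k + (\<Sum>j\<in>UNIV - {k}. ?s k i j)"
      using sum_softmax[of "logits W H b (k, i)"] by (simp add: sum.remove[of UNIV k])
    also have "(\<Sum>j\<in>UNIV - {k}. ?s k i j) = (\<Sum>j\<in>UNIV - {k}. q)"
      by (intro sum.cong) (auto simp: off)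
    also have "\<dots> = (real CARD('k) - 1) * q"
      using K by (simp add: card_Diff_singleton of_nat_diff)
    finally show ?thesis by simp
  qed
  then show thesis using off by (intro that[of q]) (auto simp: q_def softmax_pos)
qed

text \<open>The blocks of the gradient, read off from directions supported on one row of
  \<open>W\<close>, on one column of \<open>H\<close>, or on the bias.\<close>

lemma
  fixes W :: "real^'d::finite^'k::finite" and H :: "real^('k \<times> 'n::finite)^'d"
  assumes st: "stationary lW lH lb W H b"
  shows stationary_row: "(\<Sum>p\<in>UNIV. logit_grad W H b p $ k *\<^sub>R column p H) + lW *\<^sub>R row k W = 0"
    and stationary_column: "(\<Sum>k\<in>UNIV. logit_grad W H b p $ k *\<^sub>R row k W) + lH *\<^sub>R column p H = 0"
    and stationary_bias: "(\<Sum>p\<in>UNIV. logit_grad W H b p) + lb *\<^sub>R b = 0"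
proof -
  let ?G = "logit_grad W H b"
  note S = st[unfolded stationary_def, rule_format]
  note zero = vector_eq_rdot[THEN iffD1, rule_format]
  show "(\<Sum>p\<in>UNIV. ?G p $ k *\<^sub>R column p H) + lW *\<^sub>R row k W = 0"
  proof (rule zero)
    fix a :: "real^'d"
    \<comment> \<open>As a matrix, \<open>axis k a\<close> has row \<open>k\<close> equal to
      \<open>a\<close> and zeros elsewhere.\<close>
    have "axis k a *v x = axis k (a \<bullet> x)" for x
      by (auto simp: matrix_vector_mult_def vec_eq_iff axis_def inner_vec_def)
    moreover have "row k W = W $ k" by (simp add: row_def)
    ultimately show "((\<Sum>p\<in>UNIV. ?G p $ k *\<^sub>R column p H) + lW *\<^sub>R row k W) \<bullet> a = 0 \<bullet> a"
      using S[of "axis k a" 0 0]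
      by (simp add: linear_0[OF linear_column] inner_axis inner_simps inner_sum_left inner_commute[of a])
  qed
  show "(\<Sum>k\<in>UNIV. ?G p $ k *\<^sub>R row k W) + lH *\<^sub>R column p H = 0"
  proof (rule zero)
    fix a :: "real^'d"
    define dH :: "real^('k \<times> 'n)^'d" where "dH = (\<chi> l q. if q = p then a $ l else 0)"
    have col: "column q dH = (if q = p then a else 0)" for q
      by (auto simp: dH_def column_def vec_eq_iff)
    have "(\<Sum>q\<in>UNIV. ?G q \<bullet> (W *v column q dH)) = (\<Sum>q\<in>UNIV. if q = p then ?G p \<bullet> (W *v a) else 0)"
      by (intro sum.cong) (auto simp: col)
    also have "\<dots> = ?G p \<bullet> (W *v a)" by simp
    also have "\<dots> = (\<Sum>k\<in>UNIV. ?G p $ k *\<^sub>R row k W) \<bullet> a"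
      by (simp add: inner_sum_left) (simp add: inner_vec_def matrix_vector_mult_def row_def)
    finally have 1: "(\<Sum>q\<in>UNIV. ?G q \<bullet> (W *v column q dH)) = (\<Sum>k\<in>UNIV. ?G p $ k *\<^sub>R row k W) \<bullet> a" .
    have "H \<bullet> dH = (\<Sum>q\<in>UNIV. if q = p then column p H \<bullet> a else 0)"
      unfolding inner_columns by (intro sum.cong) (auto simp: col)
    then have "H \<bullet> dH = column p H \<bullet> a" by simp
    then show "((\<Sum>k\<in>UNIV. ?G p $ k *\<^sub>R row k W) + lH *\<^sub>R column p H) \<bullet> a = 0 \<bullet> a"
      using S[of 0 dH 0] 1 by (simp add: inner_add_left)
  qed
  show "(\<Sum>p\<in>UNIV. ?G p) + lb *\<^sub>R b = 0"
    by (rule zero) (use S[of 0 0] in \<open>simp add: linear_0[OF linear_column] inner_add_left inner_sum_left\<close>)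
qed

text \<open>The two-valued softmax determines \<open>G\<close> up to the factor
  \<open>\<gamma>\<close>. The column conditions align features with rows of \<open>W\<close>, the
  row conditions fix the ratio, and logarithms of the softmax outputs give the Gram matrix and the
  bias.\<close>

lemma stationary_neural_collapse:
  fixes W :: "real^'d::finite^'k::finite" and H :: "real^('k \<times> 'n::finite)^'d"
  assumes st: "stationary lW lH lb W H b" and sp: "spectral_bound (sqrt (lW * lH)) W H b"
    and pos: "0 < lW" "0 < lH" "0 \<le> lb" and K: "2 \<le> CARD('k)"
  obtains A \<beta> where "b = \<beta> *\<^sub>R (\<chi> k. 1)" "\<beta> = 0 \<or> lb = 0"
    "\<And>k i. column (k, i) H = sqrt (lW / (lH * real CARD('n))) *\<^sub>R row k W"
    "(\<Sum>k\<in>UNIV. row k W) = 0"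
    "\<And>j k. row j W \<bullet> row k W = A * ((if j = k then 1 else 0) - 1 / real CARD('k))"
proof -
  let ?G = "logit_grad W H b" and ?K = "real CARD('k)" and ?n = "real CARD('n)"
  have Kn: "0 < ?K" "0 < ?n" by simp_all
  obtain q where q: "0 < q"
    and sm: "\<And>k i j. softmax (logits W H b (k, i)) $ j = (if j = k then 1 - (?K - 1) * q else q)"
    by (rule softmax_two_valued[OF st sp pos K]) (rule that)
  define \<gamma> where "\<gamma> = q / ?n"
  have \<gamma>: "0 < \<gamma>" using q by (simp add: \<gamma>_def)
  have G: "?G (k, i) $ j = \<gamma> * (1 / ?K - (if j = k then 1 else 0))" for k i j
    using Kn by (simp add: logit_grad_def sm axis_def \<gamma>_def field_simps)
  have sumG: "(\<Sum>j\<in>UNIV. ?G p $ j) = 0" for p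
  proof -
    have "(\<Sum>j\<in>UNIV. ?G (fst p, snd p) $ j) = 0"
      unfolding G by (simp add: sum_distrib_left[symmetric] sum_subtractf)
    then show ?thesis by simp
  qed
  have split: "(\<Sum>p\<in>UNIV. g p) = (\<Sum>k\<in>UNIV. \<Sum>i\<in>UNIV. g (k, i))" for g :: "'k \<times> 'n \<Rightarrow> real^'d"
    unfolding sum.cartesian_product UNIV_Times_UNIV by simp

  define R where "R = (\<Sum>k\<in>UNIV. row k W)"
  \<comment> \<open>Sum the row conditions over the classes; each column of \<open>G\<close> sums to
    zero.\<close>
  have R: "R = 0"
  proof -
    have "(\<Sum>k\<in>UNIV. (\<Sum>p\<in>UNIV. ?G p $ k *\<^sub>R column p H) + lW *\<^sub>R row k W) = 0"
      by (simp add: stationary_row[OF st])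
    moreover have "(\<Sum>k\<in>UNIV. \<Sum>p\<in>UNIV. ?G p $ k *\<^sub>R column p H) = 0"
      by (subst sum.swap) (simp add: scaleR_sum_left[symmetric] sumG)
    ultimately show ?thesis using pos(1) by (simp add: sum.distrib R_def scaleR_sum_right[symmetric])
  qed
  have pick: "(\<Sum>j\<in>UNIV. (\<gamma> * (1 / ?K - (if j = k then 1 else 0))) *\<^sub>R row j W) = - \<gamma> *\<^sub>R row k W" for k
  proof -
    have "(\<gamma> * (1 / ?K - (if j = k then 1 else 0))) *\<^sub>R row j W
        = (\<gamma> / ?K) *\<^sub>R row j W - (if j = k then \<gamma> *\<^sub>R row k W else 0)" for j
      by (simp add: scaleR_diff_left algebra_simps)
    then have "(\<Sum>j\<in>UNIV. (\<gamma> * (1 / ?K - (if j = k then 1 else 0))) *\<^sub>R row j W) = (\<gamma> / ?K) *\<^sub>R R - \<gamma> *\<^sub>R row k W"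
      by (simp add: sum_subtractf R_def scaleR_sum_right)
    then show ?thesis by (simp add: R)
  qed
  have lHh: "lH *\<^sub>R column (k, i) H = \<gamma> *\<^sub>R row k W" for k i
    using stationary_column[OF st, of "(k, i)"] unfolding G pick by (simp add: algebra_simps)
  have h: "column (k, i) H = (\<gamma> / lH) *\<^sub>R row k W" for k i
  proof -
    have "column (k, i) H = (1 / lH) *\<^sub>R (lH *\<^sub>R column (k, i) H)" using pos(2) by simp
    then show ?thesis unfolding lHh by simp
  qed
  \<comment> \<open>Inserting \<open>h\<close> in the row condition makes a nonzero row force
    \<open>\<gamma>^2 n = lW lH\<close>, which turns \<open>\<gamma> / lH\<close> into the constant
    \<open>c\<close>. For a zero row both sides of the alignment vanish.\<close>
  have eig: "lW *\<^sub>R row k W = (\<gamma>\<^sup>2 * ?n / lH) *\<^sub>R row k W" for k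
  proof -
    have "(\<Sum>p\<in>UNIV. ?G p $ k *\<^sub>R column p H)
        = (?n * \<gamma> / lH) *\<^sub>R (\<Sum>j\<in>UNIV. (\<gamma> * (1 / ?K - (if j = k then 1 else 0))) *\<^sub>R row j W)"
      unfolding split G h scaleR_sum_right by (simp only: sum_constant_scaleR scaleR_scaleR) (simp add: mult_ac eq_commute[of k])
    also have "\<dots> = - ((\<gamma>\<^sup>2 * ?n / lH) *\<^sub>R row k W)"
      unfolding pick by (simp add: power2_eq_square mult_ac)
    finally show ?thesis using stationary_row[OF st, of k] by (simp add: algebra_simps)
  qed
  have cases: "row k W = 0 \<or> \<gamma>\<^sup>2 * ?n = lW * lH" for k
    using eig[of k] pos(2) by (auto simp: field_simps)
  define c where "c = sqrt (lW / (lH * ?n))"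
  have c: "0 < c" using pos by (simp add: c_def)
  have hc: "column (k, i) H = c *\<^sub>R row k W" for k i
  proof (cases "row k W = 0")
    case False
    then have "\<gamma>\<^sup>2 * ?n = lW * lH" using cases by blast
    then have "lW / (lH * ?n) = (\<gamma> / lH)\<^sup>2"
      using pos Kn by (simp add: field_simps power2_eq_square)
    then have "c = \<gamma> / lH" using \<gamma> pos(2) by (simp add: c_def)
    then show ?thesis by (simp add: h)
  qed (simp add: h)

  obtain i0 :: 'n where True by blast
  define \<alpha> where "\<alpha> = ln (1 - (?K - 1) * q) - ln q"
  define C where "C k = lse (logits W H b (k, i0)) + ln q" for k
  \<comment> \<open>The logits recovered from the softmax outputs; \<open>\<alpha>\<close> is the
    log ratio of the diagonal to the off-diagonal value. Any sample \<open>i0\<close> serves, since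
    samples of a class share their feature.\<close>
  have z: "c * (row j W \<bullet> row k W) + b $ j = C k + (if j = k then \<alpha> else 0)" for j k
  proof -
    have "logits W H b (k, i0) $ j = c * (row j W \<bullet> row k W) + b $ j"
      unfolding logits_def hc by (simp add: matrix_vector_mult_def inner_vec_def row_def sum_distrib_left mult_ac)
    moreover have "logits W H b (k, i0) $ j = lse (logits W H b (k, i0)) + ln (softmax (logits W H b (k, i0)) $ j)"
      by (simp add: ln_softmax)
    ultimately show ?thesis by (cases "j = k") (simp_all add: sm C_def \<alpha>_def)
  qed
  \<comment> \<open>Summing \<open>z\<close> over \<open>j\<close> kills the Gram term because
    \<open>R = 0\<close>, so \<open>C k\<close> is independent of \<open>k\<close>; summing over
    \<open>k\<close> below then makes \<open>b\<close> constant.\<close>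
  define C0 where "C0 = ((\<Sum>j\<in>UNIV. b $ j) - \<alpha>) / ?K"
  have C: "C k = C0" for k
  proof -
    have "(\<Sum>j\<in>UNIV. c * (row j W \<bullet> row k W) + b $ j) = c * (R \<bullet> row k W) + (\<Sum>j\<in>UNIV. b $ j)"
      by (simp add: sum.distrib R_def inner_sum_left sum_distrib_left)
    then have "(\<Sum>j\<in>UNIV. b $ j) = ?K * C k + \<alpha>" unfolding z by (simp add: R sum.distrib)
    then show ?thesis using Kn by (simp add: C0_def)
  qed
  define \<beta> where "\<beta> = C0 + \<alpha> / ?K"
  have b: "b $ j = \<beta>" for j
  proof -
    have "(\<Sum>k\<in>UNIV. c * (row j W \<bullet> row k W) + b $ j) = c * (row j W \<bullet> R) + ?K * b $ j"
      by (simp add: sum.distrib R_def inner_sum_right sum_distrib_left)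
    then have "?K * b $ j = ?K * C0 + \<alpha>" unfolding z C by (simp add: R sum.distrib)
    then show ?thesis using Kn by (simp add: \<beta>_def field_simps)
  qed
  \<comment> \<open>The coordinates of the bias condition add up to \<open>K lb \<beta> = 0\<close>,
    again because columns of \<open>G\<close> sum to zero.\<close>
  have lb\<beta>: "\<beta> = 0 \<or> lb = 0"
  proof -
    have "(\<Sum>k\<in>UNIV. ((\<Sum>p\<in>UNIV. ?G p) + lb *\<^sub>R b) $ k) = 0"
      by (simp only: stationary_bias[OF st]) simp
    then have "(\<Sum>k\<in>UNIV. \<Sum>p\<in>UNIV. ?G p $ k) + ?K * (lb * \<beta>) = 0"
      by (simp add: b sum.distrib)
    moreover have "(\<Sum>k\<in>UNIV. \<Sum>p\<in>UNIV. ?G p $ k) = 0" by (subst sum.swap) (simp add: sumG)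
    ultimately show ?thesis using Kn by auto
  qed
  show thesis
  proof (rule that[of \<beta> "\<alpha> / c"])
    show "b = \<beta> *\<^sub>R (\<chi> k. 1)" by (simp add: vec_eq_iff b)
    show "column (k, i) H = sqrt (lW / (lH * ?n)) *\<^sub>R row k W" for k i
      using hc by (simp add: c_def)
    show "(\<Sum>k\<in>UNIV. row k W) = 0" using R by (simp add: R_def)
    show "row j W \<bullet> row k W = \<alpha> / c * ((if j = k then 1 else 0) - 1 / ?K)" for j k
      using z[of j k] c Kn by (simp add: b C \<beta>_def field_simps split: if_splits)
  qed (rule lb\<beta>)
qed

text \<open>\<open>U\<close> cancels through \<open>transpose U ** U = mat 1\<close>, leaving the
  Gram matrix of the rows of \<open>W\<close>.\<close>

lemma gram_scaled_rotated:
  fixes W :: "real^'d::finite^'k::finite" and U :: "real^'d^'d"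
  assumes "transpose U ** U = mat 1"
  shows "transpose (x *\<^sub>R (U ** transpose W)) ** (x *\<^sub>R (U ** transpose W)) = (\<chi> j k. x\<^sup>2 * (row j W \<bullet> row k W))"
proof -
  have "transpose (U ** transpose W) ** (U ** transpose W) = W ** (transpose U ** U) ** transpose W"
    by (simp add: matrix_transpose_mul matrix_mul_assoc)
  also have "\<dots> = (\<chi> j k. row j W \<bullet> row k W)"
    unfolding assms matrix_mul_rid by (simp add: matrix_matrix_mult_def vec_eq_iff inner_vec_def row_def transpose_def)
  finally have "transpose (U ** transpose W) ** (U ** transpose W) = (\<chi> j k. row j W \<bullet> row k W)" .
  moreover have "transpose (x *\<^sub>R A) ** (x *\<^sub>R A) = x\<^sup>2 *\<^sub>R (transpose A ** A)" for A :: "real^'k^'d"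
    by (simp add: matrix_matrix_mult_def transpose_def vec_eq_iff sum_distrib_left power2_eq_square mult_ac)
  ultimately show ?thesis by (simp add: vec_eq_iff)
qed

text \<open>The ETF clause is guarded by \<open>w \<noteq> 0\<close> because the normalization
  divides by \<open>w\<close>. If \<open>w = 0\<close>, then \<open>W\<close> and \<open>H\<close>
  vanish, as happens under strong regularization.\<close>

theorem theorem3p2:
  fixes lW lH lb :: real
  assumes K: "2 \<le> CARD('k::finite)" and d: "CARD('k) < CARD('d::finite)"
    and lW: "0 < lW" and lH: "0 < lH" and lb: "0 \<le> lb"
  shows "(\<forall>(W :: real^'d^'k) (H :: real^('k \<times> 'n::finite)^'d) (b :: real^'k).
      local_minimizer (ufm_obj lW lH lb) (W, H, b) \<longrightarrow>
      global_minimizer (ufm_obj lW lH lb) (W, H, b) \<and>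
      (\<exists>w \<beta>.
        (\<forall>k. norm (row k W) = w) \<and>
        b = \<beta> *\<^sub>R (\<chi> k. 1) \<and>
        (\<forall>k i. column (k, i) H = sqrt (lW / (lH * real CARD('n))) *\<^sub>R row k W) \<and>
        (\<forall>i. (1 / real CARD('k)) *\<^sub>R (\<Sum>j\<in>UNIV. column (j, i) H) = 0) \<and>
        (\<beta> = 0 \<or> lb = 0) \<and>
        (w \<noteq> 0 \<longrightarrow>
          (\<forall>U :: real^'d^'d. transpose U ** U = mat 1 \<longrightarrow>
            (let M = (1 / w) *\<^sub>R (U ** transpose W) in
              transpose M ** M = (real CARD('k) / (real CARD('k) - 1)) *\<^sub>R
                (mat 1 - (1 / real CARD('k)) *\<^sub>R (\<chi> i j. 1)))))))
    \<and> (\<forall>(W :: real^'d^'k) (H :: real^('k \<times> 'n)^'d) (b :: real^'k).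
      critical_point (ufm_obj lW lH lb) (W, H, b) \<and>
      \<not> local_minimizer (ufm_obj lW lH lb) (W, H, b) \<longrightarrow>
      strict_saddle (ufm_obj lW lH lb) (W, H, b))"
proof (intro conjI allI impI)
  fix W :: "real^'d^'k" and H :: "real^('k \<times> 'n)^'d" and b :: "real^'k"
  assume lm: "local_minimizer (ufm_obj lW lH lb) (W, H, b)"
  then have st: "stationary lW lH lb W H b" by (rule local_minimizer_imp_stationary)
  have sp: "spectral_bound (sqrt (lW * lH)) W H b"
  proof (rule ccontr)
    assume "\<not> ?thesis"
    from quadratic_descent_direction[OF st this lW lH d]
    show False using not_local_minimizer_of_quadratic_descent lm by metis
  qed
  show "global_minimizer (ufm_obj lW lH lb) (W, H, b)"
    by (rule stationary_spectral_bound_imp_global_minimizer[OF st sp lW lH lb])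
  let ?K = "real CARD('k)"
  have K1: "1 < ?K" using K by simp
  obtain A \<beta> where b: "b = \<beta> *\<^sub>R (\<chi> k. 1)" and \<beta>: "\<beta> = 0 \<or> lb = 0"
    and H: "\<And>k i. column (k, i) H = sqrt (lW / (lH * real CARD('n))) *\<^sub>R row k W"
    and W0: "(\<Sum>k\<in>UNIV. row k W) = 0"
    and gram: "\<And>j k. row j W \<bullet> row k W = A * ((if j = k then 1 else 0) - 1 / ?K)"
    by (rule stationary_neural_collapse[OF st sp lW lH lb K]) (rule that)
  define w where "w = sqrt (A * (1 - 1 / ?K))"
  have w: "norm (row k W) = w" for k by (simp add: norm_eq_sqrt_inner gram w_def)
  \<comment> \<open>\<open>undefined\<close> is an arbitrary class; passing through a row norm
    avoids proving \<open>A \<ge> 0\<close>.\<close>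
  have w2: "w\<^sup>2 = A * (1 - 1 / ?K)"
    using w[of undefined] gram[of undefined undefined] by (simp add: dot_square_norm)
  have "\<forall>U :: real^'d^'d. transpose U ** U = mat 1 \<longrightarrow>
      (let M = (1 / w) *\<^sub>R (U ** transpose W) in
        transpose M ** M = (?K / (?K - 1)) *\<^sub>R (mat 1 - (1 / ?K) *\<^sub>R (\<chi> i j. 1)))" if "w \<noteq> 0"
  proof -
    have "A \<noteq> 0" using w2 that by auto
    \<comment> \<open>Dividing by \<open>w^2 = A (1 - 1/K)\<close> cancels \<open>A\<close> and
      produces the factor \<open>K / (K - 1)\<close>.\<close>
    then have "(1 / w)\<^sup>2 * (row j W \<bullet> row k W) = ?K / (?K - 1) * ((if j = k then 1 else 0) - 1 / ?K)" for j k
      unfolding gram power_divide w2 using K1 by (simp add: field_simps)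
    then show ?thesis
      unfolding Let_def by (auto simp: gram_scaled_rotated vec_eq_iff mat_def)
  qed
  moreover have "(\<Sum>j\<in>UNIV. column (j, i) H) = 0" for i
    by (simp add: H scaleR_sum_right[symmetric] W0)
  ultimately show "\<exists>w \<beta>.
        (\<forall>k. norm (row k W) = w) \<and>
        b = \<beta> *\<^sub>R (\<chi> k. 1) \<and>
        (\<forall>k i. column (k, i) H = sqrt (lW / (lH * real CARD('n))) *\<^sub>R row k W) \<and>
        (\<forall>i. (1 / real CARD('k)) *\<^sub>R (\<Sum>j\<in>UNIV. column (j, i) H) = 0) \<and>
        (\<beta> = 0 \<or> lb = 0) \<and>
        (w \<noteq> 0 \<longrightarrow>
          (\<forall>U :: real^'d^'d. transpose U ** U = mat 1 \<longrightarrow>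
            (let M = (1 / w) *\<^sub>R (U ** transpose W) in
              transpose M ** M = (real CARD('k) / (real CARD('k) - 1)) *\<^sub>R
                (mat 1 - (1 / real CARD('k)) *\<^sub>R (\<chi> i j. 1)))))"
    using w b H \<beta> by (intro exI[of _ w] exI[of _ \<beta>]) simp
next
  fix W :: "real^'d^'k" and H :: "real^('k \<times> 'n)^'d" and b :: "real^'k"
  assume "critical_point (ufm_obj lW lH lb) (W, H, b) \<and> \<not> local_minimizer (ufm_obj lW lH lb) (W, H, b)"
  then have cp: "critical_point (ufm_obj lW lH lb) (W, H, b)"
    and nlm: "\<not> local_minimizer (ufm_obj lW lH lb) (W, H, b)" by auto
  have st: "stationary lW lH lb W H b" using cp by (rule critical_point_imp_stationary)
  have sp: "\<not> spectral_bound (sqrt (lW * lH)) W H b"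
  proof
    assume "spectral_bound (sqrt (lW * lH)) W H b"
    from stationary_spectral_bound_imp_global_minimizer[OF st this lW lH lb] nlm
    show False unfolding global_minimizer_def local_minimizer_def by (metis always_eventually)
  qed
  from quadratic_descent_direction[OF st sp lW lH d] obtain D \<psi> \<psi>' where
    "\<And>\<tau>. ufm_obj lW lH lb ((W, H, b) + \<tau> *\<^sub>R D) = \<psi> (\<tau>\<^sup>2)"
    "\<And>s. (\<psi> has_real_derivative \<psi>' s) (at s)" "isCont \<psi>' 0" "\<psi>' 0 < 0" by metis
  from negative_eigenvalue_of_quadratic_descent[OF sym_twice_diff_ufm_obj this] cp
  show "strict_saddle (ufm_obj lW lH lb) (W, H, b)" by (simp add: strict_saddle_def)
qed

end
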